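(* Assume $f:\mathbb{R}^n\to\mathbb{R}$ is twice differentiable and $-MI\preceq G(x)\preceq MI$ for all $x$ in the convex hull of the level set $\{x\in\mathbb{R}^n:f(x)\le f(x_1)\}$, where $M>0$ is a constant and $x_1=x_1^{(1)}$ is the starting point. Suppose that $\{\widetilde G_k\}_{k=1}^\infty$ is a sequence of symmetric matrices satisfying, for all $k$, the conditions (1) $-MI\preceq\widetilde G_k\preceq MI$; (2) for some constant $\eta>0$, the matrix $D_k$ produced by $\mathrm{FILTERSTEPS}(S_k,\widetilde G_k)$ satisfies $D_k^T\widetilde G_kD_k\succeq\eta D_k^TD_k$. Then we may perform Block BFGS using the updates $$B_{k+1}=B_k-B_kD_k(D_k^TB_kD_k)^{-1}D_k^TB_k+\widetilde G_kD_k(D_k^T\widetilde G_kD_k)^{-1}D_k^T\widetilde G_k$$ and Block BFGS converges in the sense that $\liminf_k\|g_k\|=0$, where $g_k$ is the gradient of $f$ at the $k$-th point of the sequence of all iterates $x_1^{(1)},\dots,x_1^{(q)},x_2^{(1)},\dots,x_2^{(q)},\dots$.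
   Context: Notation: $\|\cdot\|$ is the Euclidean norm, $\langle\cdot,\cdot\rangle$ the standard inner product, $g(x)=\nabla f(x)$, $G(x)=\nabla^2 f(x)$, $I$ is the identity matrix, and $A\preceq B$ (equivalently $B\succeq A$) means $B-A$ is positive semidefinite. Block BFGS with matrices $\widetilde G_k$. Inputs: a starting point $x_1^{(1)}=x_1\in\mathbb{R}^n$, a symmetric positive definite matrix $B_1\in\mathbb{R}^{n\times n}$, an integer $q\ge 1$, a filter threshold $\tau>0$, and line search parameters $0<\alpha<\frac12$, $\alpha<\beta<1$. For $k=1,2,3,\dots$: (i) For $i=1,\dots,q$: put $g_k^{(i)}=g(x_k^{(i)})$ and $d_k^{(i)}=-B_k^{-1}g_k^{(i)}$; the line search selects a step size $\lambda=\lambda_k^{(i)}>0$ satisfying the Armijo-Wolfe conditions $f(x_k^{(i)}+\lambda d_k^{(i)})\le f(x_k^{(i)})+\alpha\lambda\langle g_k^{(i)},d_k^{(i)}\rangle$ and $\langle g(x_k^{(i)}+\lambda d_k^{(i)}),d_k^{(i)}\rangle\ge\beta\langle g_k^{(i)},d_k^{(i)}\rangle$, where $\lambda=1$ is always selected whenever it satisfies both conditions; put $s_k^{(i)}=\lambda_k^{(i)}d_k^{(i)}$ and $x_k^{(i+1)}=x_k^{(i)}+s_k^{(i)}$. (ii) Put $S_k=[s_k^{(1)}\ \cdots\ s_k^{(q)}]$ and $D_k=\mathrm{FILTERSTEPS}(S_k,\widetilde G_k)$. (iii) If $D_k$ is not empty, define $B_{k+1}$ by the update formula in the claim; if $D_k$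 is empty, put $B_{k+1}=B_k$. Put $x_{k+1}^{(1)}=x_k^{(q+1)}$. FILTERSTEPS$(S,\widetilde G)$ with threshold $\tau$: go through the columns of $S$ from left to right, keeping a list of retained columns, initially empty. If $D'$ is the matrix of columns retained so far and $s$ is the next column, let $\sigma^2=s^T\widetilde Gs-s^T\widetilde GD'(D'^T\widetilde GD')^{-1}D'^T\widetilde Gs$ (the second term is absent if $D'$ is empty); retain $s$ if $\sigma^2\ge\tau\|s\|^2$, otherwise discard it. The output $D$ is the matrix of retained columns; the values $\sigma^2$ of the retained columns are the diagonal entries of $\Sigma$ in the factorization $D^T\widetilde GD=L\Sigma L^T$ with $L$ unit lower triangular and $\Sigma$ diagonal. The algorithm is understood to run without terminating, i.e. no iterate has zero gradient. Condition (2) is vacuous for $k$ with $D_k$ empty.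
   Formalization: The formal theorem additionally assumes that f is bounded below; without this the claim fails, e.g. f(x) = -x admits no Armijo-Wolfe step, and f(x) = -sqrt(1+x^2) + 2 sin x with all matrices G̃_k = 0 admits a run whose gradients stay away from zero. *)

theory Defs
  imports "HOL-Analysis.Analysis" "Jordan_Normal_Form.Gauss_Jordan_Elimination"
begin

text \<open>
  Vectors of $R^n$ and the matrices of order $n$ use the types \<^typ>\<open>real ^ 'n\<close> and
  \<^typ>\<open>real ^ 'n ^ 'n\<close>. The number of columns of $D_k$ changes from block to block, so a matrix
  with $n$ rows and $m$ columns is the list of its $m$ columns, and the matrices of order $m$
  built from it are matrices of \<^theory>\<open>Jordan_Normal_Form.Matrix\<close>.
\<close>

definition psd :: "real ^ 'n ^ 'n \<Rightarrow> bool" where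
  "psd A \<longleftrightarrow> Finite_Cartesian_Product.transpose A = A \<and> (\<forall>v. 0 \<le> inner v (A *v v))"

definition pos_def :: "real ^ 'n ^ 'n \<Rightarrow> bool" where
  "pos_def A \<longleftrightarrow> Finite_Cartesian_Product.transpose A = A \<and> (\<forall>v. v \<noteq> 0 \<longrightarrow> 0 < inner v (A *v v))"

definition loewner_le :: "real ^ 'n ^ 'n \<Rightarrow> real ^ 'n ^ 'n \<Rightarrow> bool"  (infix \<open>\<preceq>\<^sub>L\<close> 50) where
  "A \<preceq>\<^sub>L B \<longleftrightarrow> psd (B - A)"

definition id_matrix :: "real ^ 'n ^ 'n" where
  "id_matrix = Finite_Cartesian_Product.mat 1"

definition psd_mat :: "real mat \<Rightarrow> bool" where
  "psd_mat A \<longleftrightarrow> square_mat A \<and> transpose_mat A = A \<and>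
     (\<forall>v \<in> carrier_vec (dim_row A). 0 \<le> scalar_prod v (mult_mat_vec A v))"

definition loewner_le_mat :: "real mat \<Rightarrow> real mat \<Rightarrow> bool"  (infix \<open>\<preceq>\<^sub>M\<close> 50) where
  "A \<preceq>\<^sub>M B \<longleftrightarrow> psd_mat (B - A)"

text \<open>The matrix $D^T A D$, where $D$ is the list of its columns.\<close>

definition congr :: "(real ^ 'n) list \<Rightarrow> real ^ 'n ^ 'n \<Rightarrow> real mat" where
  "congr D A = Matrix.mat (length D) (length D) (\<lambda>(i, j). inner (D ! i) (A *v (D ! j)))"

text \<open>
  The matrix $D C D^T = \sum_{i,j} C_{ij} d_i d_j^T$, where $d_0, \dots, d_{m-1}$ are the columns
  of $D$. It is zero if $D$ has no columns.
\<close>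

definition spread :: "(real ^ 'n) list \<Rightarrow> real mat \<Rightarrow> real ^ 'n ^ 'n" where
  "spread D C = (\<Sum>i<length D. \<Sum>j<length D.
     index_mat C (i, j) *\<^sub>R (\<chi> a b. vec_nth (D ! i) a * vec_nth (D ! j) b))"

text \<open>The matrix $A D (D^T A D)^{-1} D^T A$; meaningful only if $D^T A D$ is invertible.\<close>

definition block_term :: "real ^ 'n ^ 'n \<Rightarrow> (real ^ 'n) list \<Rightarrow> real ^ 'n ^ 'n" where
  "block_term A D = A ** spread D (the (mat_inverse (congr D A))) ** A"

definition sigma2 :: "real ^ 'n ^ 'n \<Rightarrow> (real ^ 'n) list \<Rightarrow> real ^ 'n \<Rightarrow> real" where
  "sigma2 Gt D s = inner s (Gt *v s) - inner s (block_term Gt D *v s)"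

text \<open>The first list argument of \<open>filter_from\<close> holds the columns retained so far.\<close>

fun filter_from ::
  "real \<Rightarrow> real ^ 'n ^ 'n \<Rightarrow> (real ^ 'n) list \<Rightarrow> (real ^ 'n) list \<Rightarrow> (real ^ 'n) list" where
  "filter_from \<tau> Gt D [] = D"
| "filter_from \<tau> Gt D (s # S) =
     filter_from \<tau> Gt (if sigma2 Gt D s \<ge> \<tau> * (norm s)\<^sup>2 then D @ [s] else D) S"

definition filter_steps ::
  "real \<Rightarrow> (real ^ 'n) list \<Rightarrow> real ^ 'n ^ 'n \<Rightarrow> (real ^ 'n) list" where
  "filter_steps \<tau> S Gt = filter_from \<tau> Gt [] S"

definition block_update ::
  "real ^ 'n ^ 'n \<Rightarrow> real ^ 'n ^ 'n \<Rightarrow> (real ^ 'n) list \<Rightarrow> real ^ 'n ^ 'n" where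
  "block_update B Gt D = (if D = [] then B else B - block_term B D + block_term Gt D)"

definition armijo_wolfe ::
  "(real ^ 'n \<Rightarrow> real) \<Rightarrow> (real ^ 'n \<Rightarrow> real ^ 'n) \<Rightarrow> real \<Rightarrow> real \<Rightarrow>
   real ^ 'n \<Rightarrow> real ^ 'n \<Rightarrow> real \<Rightarrow> bool" where
  "armijo_wolfe f g \<alpha> \<beta> x d t \<longleftrightarrow> 0 < t \<and>
     f (x + t *\<^sub>R d) \<le> f x + \<alpha> * t * inner (g x) d \<and>
     inner (g (x + t *\<^sub>R d)) d \<ge> \<beta> * inner (g x) d"

definition selectable ::
  "(real ^ 'n \<Rightarrow> real) \<Rightarrow> (real ^ 'n \<Rightarrow> real ^ 'n) \<Rightarrow> real \<Rightarrow> real \<Rightarrow>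
   real ^ 'n \<Rightarrow> real ^ 'n \<Rightarrow> real \<Rightarrow> bool" where
  "selectable f g \<alpha> \<beta> x d t \<longleftrightarrow> armijo_wolfe f g \<alpha> \<beta> x d t \<and>
     (armijo_wolfe f g \<alpha> \<beta> x d 1 \<longrightarrow> t = 1)"

text \<open>
  Below, \<open>x k i\<close>, \<open>lam k i\<close>, \<open>B k\<close> and \<open>Gt k\<close> are $x_k^{(i)}$, $\lambda_k^{(i)}$, $B_k$ and
  $\widetilde G_k$, with $k \ge 1$ and $i \ge 1$ as in the algorithm; the values at index 0 play
  no role.
\<close>

definition direction ::
  "(real ^ 'n \<Rightarrow> real ^ 'n) \<Rightarrow> (nat \<Rightarrow> real ^ 'n ^ 'n) \<Rightarrow> (nat \<Rightarrow> nat \<Rightarrow> real ^ 'n) \<Rightarrow>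
   nat \<Rightarrow> nat \<Rightarrow> real ^ 'n" where
  "direction g B x k i = - (matrix_inv (B k) *v g (x k i))"

definition step_matrix ::
  "(real ^ 'n \<Rightarrow> real ^ 'n) \<Rightarrow> nat \<Rightarrow> (nat \<Rightarrow> real ^ 'n ^ 'n) \<Rightarrow>
   (nat \<Rightarrow> nat \<Rightarrow> real ^ 'n) \<Rightarrow> (nat \<Rightarrow> nat \<Rightarrow> real) \<Rightarrow> nat \<Rightarrow> (real ^ 'n) list" where
  "step_matrix g q B x lam k = map (\<lambda>i. lam k i *\<^sub>R direction g B x k i) [1..<Suc q]"

definition retained ::
  "(real ^ 'n \<Rightarrow> real ^ 'n) \<Rightarrow> nat \<Rightarrow> real \<Rightarrow> (nat \<Rightarrow> real ^ 'n ^ 'n) \<Rightarrow>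
   (nat \<Rightarrow> real ^ 'n ^ 'n) \<Rightarrow> (nat \<Rightarrow> nat \<Rightarrow> real ^ 'n) \<Rightarrow> (nat \<Rightarrow> nat \<Rightarrow> real) \<Rightarrow>
   nat \<Rightarrow> (real ^ 'n) list" where
  "retained g q \<tau> Gt B x lam k = filter_steps \<tau> (step_matrix g q B x lam k) (Gt k)"

text \<open>A step is taken only from a point with nonzero gradient.\<close>

definition inner_step ::
  "(real ^ 'n \<Rightarrow> real) \<Rightarrow> (real ^ 'n \<Rightarrow> real ^ 'n) \<Rightarrow> real \<Rightarrow> real \<Rightarrow>
   (nat \<Rightarrow> real ^ 'n ^ 'n) \<Rightarrow> (nat \<Rightarrow> nat \<Rightarrow> real ^ 'n) \<Rightarrow> (nat \<Rightarrow> nat \<Rightarrow> real) \<Rightarrow>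
   nat \<Rightarrow> nat \<Rightarrow> bool" where
  "inner_step f g \<alpha> \<beta> B x lam k i \<longleftrightarrow> g (x k i) \<noteq> 0 \<and>
     selectable f g \<alpha> \<beta> (x k i) (direction g B x k i) (lam k i) \<and>
     x k (Suc i) = x k i + lam k i *\<^sub>R direction g B x k i"

definition outer_step ::
  "(real ^ 'n \<Rightarrow> real ^ 'n) \<Rightarrow> nat \<Rightarrow> real \<Rightarrow> (nat \<Rightarrow> real ^ 'n ^ 'n) \<Rightarrow>
   (nat \<Rightarrow> real ^ 'n ^ 'n) \<Rightarrow> (nat \<Rightarrow> nat \<Rightarrow> real ^ 'n) \<Rightarrow> (nat \<Rightarrow> nat \<Rightarrow> real) \<Rightarrow>
   nat \<Rightarrow> bool" where
  "outer_step g q \<tau> Gt B x lam k \<longleftrightarrow>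
     B (Suc k) = block_update (B k) (Gt k) (retained g q \<tau> Gt B x lam k) \<and>
     x (Suc k) 1 = x k (Suc q)"

text \<open>
  \<open>bfgs_until \<dots> K I\<close>: the algorithm has completed the blocks before \<open>K\<close> and the steps before \<open>I\<close>
  of block \<open>K\<close>, so that it has reached the point \<open>x K I\<close>.
\<close>

definition bfgs_until ::
  "(real ^ 'n \<Rightarrow> real) \<Rightarrow> (real ^ 'n \<Rightarrow> real ^ 'n) \<Rightarrow> nat \<Rightarrow> real \<Rightarrow> real \<Rightarrow> real \<Rightarrow>
   real ^ 'n \<Rightarrow> real ^ 'n ^ 'n \<Rightarrow> (nat \<Rightarrow> real ^ 'n ^ 'n) \<Rightarrow>
   (nat \<Rightarrow> real ^ 'n ^ 'n) \<Rightarrow> (nat \<Rightarrow> nat \<Rightarrow> real ^ 'n) \<Rightarrow> (nat \<Rightarrow> nat \<Rightarrow> real) \<Rightarrow>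
   nat \<Rightarrow> nat \<Rightarrow> bool" where
  "bfgs_until f g q \<tau> \<alpha> \<beta> x1 B1 Gt B x lam K I \<longleftrightarrow>
     x 1 1 = x1 \<and> B 1 = B1 \<and>
     (\<forall>k \<in> {1..<K}. (\<forall>i \<in> {1..q}. inner_step f g \<alpha> \<beta> B x lam k i) \<and>
        outer_step g q \<tau> Gt B x lam k) \<and>
     (\<forall>i \<in> {1..<I}. inner_step f g \<alpha> \<beta> B x lam K i)"

definition bfgs_run ::
  "(real ^ 'n \<Rightarrow> real) \<Rightarrow> (real ^ 'n \<Rightarrow> real ^ 'n) \<Rightarrow> nat \<Rightarrow> real \<Rightarrow> real \<Rightarrow> real \<Rightarrow>
   real ^ 'n \<Rightarrow> real ^ 'n ^ 'n \<Rightarrow> (nat \<Rightarrow> real ^ 'n ^ 'n) \<Rightarrow>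
   (nat \<Rightarrow> real ^ 'n ^ 'n) \<Rightarrow> (nat \<Rightarrow> nat \<Rightarrow> real ^ 'n) \<Rightarrow> (nat \<Rightarrow> nat \<Rightarrow> real) \<Rightarrow> bool" where
  "bfgs_run f g q \<tau> \<alpha> \<beta> x1 B1 Gt B x lam \<longleftrightarrow>
     x 1 1 = x1 \<and> B 1 = B1 \<and>
     (\<forall>k \<ge> 1. (\<forall>i \<in> {1..q}. inner_step f g \<alpha> \<beta> B x lam k i) \<and>
        outer_step g q \<tau> Gt B x lam k)"

text \<open>Conditions (1) and (2) on one matrix $\widetilde G$; (2) is vacuous if \<open>D\<close> is empty.\<close>

definition admissible :: "real \<Rightarrow> real \<Rightarrow> (real ^ 'n) list \<Rightarrow> real ^ 'n ^ 'n \<Rightarrow> bool" where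
  "admissible M \<eta> D Gt \<longleftrightarrow> Finite_Cartesian_Product.transpose Gt = Gt \<and>
     - (M *\<^sub>R id_matrix) \<preceq>\<^sub>L Gt \<and> Gt \<preceq>\<^sub>L M *\<^sub>R id_matrix \<and>
     (D \<noteq> [] \<longrightarrow> smult_mat \<eta> (congr D id_matrix) \<preceq>\<^sub>M congr D Gt)"

text \<open>The sequence $x_1^{(1)}, \dots, x_1^{(q)}, x_2^{(1)}, \dots, x_2^{(q)}, \dots$, from index 0.\<close>

definition iterate :: "nat \<Rightarrow> (nat \<Rightarrow> nat \<Rightarrow> real ^ 'n) \<Rightarrow> nat \<Rightarrow> real ^ 'n" where
  "iterate q x N = x (Suc (N div q)) (Suc (N mod q))"

end

theory Submission
  imports Defs "Jordan_Normal_Form.Determinant"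
begin

text \<open>
  A block update is a sequence of ordinary BFGS updates. If $p_1, \dots, p_m$ arises from the
  columns of $D$ by Gram--Schmidt orthogonalisation with respect to $\widetilde G$, then the
  block update of $B$ is the result of the updates with the pairs $(p_j, \widetilde G p_j)$,
  $j = 1, \dots, m$ (\<open>block_update_snoc\<close>). The reason is that the block term
  $A D (D^T A D)^{-1} D^T A$ is the $A$-orthogonal projection onto the span of $D$ followed by $A$,
  and this projection grows by one rank-one term for each new column. The steps are not zero, so
  the filter retains a column $s$ only if $\sigma^2 \ge \tau \|s\|^2 > 0$, and $\sigma^2$ is the
  value of the quadratic form of $\widetilde G$ at the new direction $p_j$; so
  $\widetilde G$ is positive definite on the span of $D$, although it may be indefinite, and every
  one of the updates preserves positive definiteness.

  Convergence rests on the merit function $\psi(B) = \mathrm{tr}\, B - \ln |\det B|$ of Byrd and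
  Nocedal. It is bounded below on the positive definite matrices. Let
  $\cos^2(B, p) = (p^T B p)^2 / (\|p\|^2 \|B p\|^2)$. One BFGS update with $(p, y)$
  changes the trace by $- \|Bp\|^2 / p^T B p + \|y\|^2 / y^T p$ and multiplies the determinant by
  $y^T p / p^T B p$, so it raises $\psi$ by at most a constant plus $\ln \cos^2(B, p)$, where the
  constant depends only on bounds for $y^T p / \|p\|^2$ and $\|y\| / \|p\|$. This has two
  consequences. A block update with at least one retained step raises $\psi$ by at most a constant
  plus the logarithm of $\cos^2$ at the first retained step, since $p_1$ is that step and the other
  logarithms are not positive (\<open>merit_block_update\<close>). And, using the fictitious pair $(s, s)$
  together with the lower bound on $\psi$, every $\ln \cos^2(B, s)$ is at least a constant minus $\psi(B)$
  (\<open>ln_cos2_lower_bound\<close>).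

  The Armijo and Wolfe conditions and the Hessian bound give
  $\langle g, s \rangle^2 / \|s\|^2 \to 0$ along the run (\<open>zoutendijk\<close>). The quasi-Newton equation
  $B s = - \lambda g$ turns the left-hand side into $\|g\|^2 \cos^2(B, s)$. If the gradients stayed
  away from zero, then $\cos^2 \to 0$; so from some block on $\psi(B_k)$ would not increase, whether
  or not any step is retained. Then the second consequence would keep $\cos^2$ away from zero,
  a contradiction.
\<close>

no_notation vec_index (infixl "$" 100)

section \<open>Rank-one updates and the BFGS formula\<close>

definition outer :: "real ^ 'n \<Rightarrow> real ^ 'n \<Rightarrow> real ^ 'n ^ 'n" where
  "outer u v = (\<chi> a b. u $ a * v $ b)"

lemma outer_mult_vec: "outer u v *v w = inner v w *\<^sub>R u"
  by (simp add: outer_def Finite_Cartesian_Product.vec_eq_iff matrix_vector_mult_def inner_vec_def sum_distrib_left mult_ac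
      flip: sum_distrib_left)

lemma trace_outer: "trace (outer u v) = inner u v"
  by (simp add: trace_def outer_def inner_vec_def)

lemma symmetric_inner:
  fixes A :: "real ^ 'n ^ 'n"
  assumes "Finite_Cartesian_Product.transpose A = A"
  shows "inner (A *v u) v = inner u (A *v v)"
  by (metis assms dot_lmul_matrix transpose_matrix_vector)

text \<open>
  The determinant is linear in each row, and a matrix with two rows equal to \<open>v\<close> is singular, so
  only the terms with at most one modified row survive. Adding the multiples of \<open>v\<close> row by row
  makes this an induction.
\<close>

lemma det_rank_one_rows:
  fixes A :: "real ^ 'n ^ 'n" and u v :: "real ^ 'n"
  assumes "finite S"
  shows "Determinants.det (\<chi> i. if i \<in> S then A $ i + u $ i *s v else A $ i) =
    Determinants.det A + (\<Sum>i\<in>S. u $ i * Determinants.det (\<chi> k. if k = i then v else A $ k))"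
  using assms
proof (induction S arbitrary: A)
  case empty
  then show ?case by simp
next
  case (insert j S)
  let ?mod = "\<lambda>S (A :: real ^ 'n ^ 'n). (\<chi> i. if i \<in> S then A $ i + u $ i *s v else A $ i) :: real ^ 'n ^ 'n"
  let ?A = "(\<chi> k. if k = j then v else A $ k) :: real ^ 'n ^ 'n"
  have "Determinants.det (?mod (insert j S) A) =
      Determinants.det (\<chi> i. if i = j then A $ j + u $ j *s v else ?mod S A $ i)"
    by (rule arg_cong[where f = Determinants.det]) (auto simp: Finite_Cartesian_Product.vec_eq_iff)
  also have "\<dots> = Determinants.det (\<chi> i. if i = j then A $ j else ?mod S A $ i)
      + u $ j * Determinants.det (\<chi> i. if i = j then v else ?mod S A $ i)"
    using Determinants.det_row_add[where k = j and a = "\<lambda>_. A $ j" and b = "\<lambda>_. u $ j *s v" and c = "\<lambda>i. ?mod S A $ i"]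
      Determinants.det_row_mul[where k = j and c = "u $ j" and a = "\<lambda>_. v" and b = "\<lambda>i. ?mod S A $ i"]
    by simp
  also have "(\<chi> i. if i = j then A $ j else ?mod S A $ i) = ?mod S A"
    using insert.hyps by (auto simp: Finite_Cartesian_Product.vec_eq_iff)
  also have "(\<chi> i. if i = j then v else ?mod S A $ i) = ?mod S ?A"
    using insert.hyps by (auto simp: Finite_Cartesian_Product.vec_eq_iff)
  also have "Determinants.det (?mod S ?A) = Determinants.det ?A"
  proof -
    \<comment> \<open>Rows \<open>i\<close> and \<open>j\<close> both equal \<open>v\<close>.\<close>
    have "Determinants.det (\<chi> k. if k = i then v else ?A $ k) = 0" if "i \<in> S" for i
      using that insert.hyps
      by (intro Determinants.det_identical_rows[of i j]) (auto simp: Finite_Cartesian_Product.row_def Finite_Cartesian_Product.vec_eq_iff)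
    then show ?thesis unfolding insert.IH by simp
  qed
  finally show ?case
    using insert.hyps unfolding insert.IH by simp
qed

lemma det_rank_one_update:
  fixes u v :: "real ^ 'n"
  shows "Determinants.det (Finite_Cartesian_Product.mat 1 + outer u v) = 1 + inner u v"
proof -
  let ?I = "Finite_Cartesian_Product.mat 1 :: real ^ 'n ^ 'n"
  have "Determinants.det (\<chi> k. if k = i then v else ?I $ k) = v $ i" for i
  proof -
    have comb: "(\<Sum>l\<in>UNIV. v $ l *s Finite_Cartesian_Product.row l ?I) = v"
      by (simp add: Finite_Cartesian_Product.vec_eq_iff Finite_Cartesian_Product.row_def Finite_Cartesian_Product.mat_def
          if_distrib cong: if_cong)
    have rw: "Finite_Cartesian_Product.row k ?I = ?I $ k" for k
      by (simp add: Finite_Cartesian_Product.vec_eq_iff Finite_Cartesian_Product.row_def)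
    show ?thesis
      using cramer_lemma_transpose[of i v ?I] unfolding comb unfolding rw by simp
  qed
  moreover have "?I + outer u v = (\<chi> i. if i \<in> UNIV then ?I $ i + u $ i *s v else ?I $ i)"
    by (simp add: Finite_Cartesian_Product.vec_eq_iff outer_def)
  ultimately show ?thesis
    using det_rank_one_rows[of UNIV ?I u v] by (simp add: inner_vec_def)
qed

definition bfgs_update :: "real ^ 'n ^ 'n \<Rightarrow> real ^ 'n \<Rightarrow> real ^ 'n \<Rightarrow> real ^ 'n ^ 'n" where
  "bfgs_update B p y = B - (1 / inner p (B *v p)) *\<^sub>R outer (B *v p) (B *v p)
     + (1 / inner y p) *\<^sub>R outer y y"

lemma bfgs_update_mult_vec:
  "bfgs_update B p y *v w = B *v w - (inner (B *v p) w / inner p (B *v p)) *\<^sub>R (B *v p)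
     + (inner y w / inner y p) *\<^sub>R y"
  by (simp add: bfgs_update_def matrix_vector_mult_add_rdistrib matrix_vector_mult_diff_rdistrib
      outer_mult_vec flip: scaleR_matrix_vector_assoc)

text \<open>
  With $b = B p$, $\sigma = p^T B p$ and $\theta^2 = \sigma / y^T p$, the vector
  $z = (\theta y - b) / \sigma$ satisfies $(I + z p^T) B (I + p z^T) =
  B - b b^T / \sigma + y y^T / y^T p$, because the mixed terms in $b$ and $y$ cancel. This one
  factorisation gives both the determinant of the update and its positive definiteness.
\<close>

lemma bfgs_update_congruence:
  fixes B :: "real ^ 'n ^ 'n"
  assumes sym: "Finite_Cartesian_Product.transpose B = B"
    and \<sigma>: "0 < inner p (B *v p)" and yp: "0 < inner y p"
  obtains F where "bfgs_update B p y = F ** B ** Finite_Cartesian_Product.transpose F"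
    and "(Determinants.det F)\<^sup>2 = inner y p / inner p (B *v p)"
proof -
  define \<sigma> where "\<sigma> = inner p (B *v p)"
  define b where "b = B *v p"
  define \<theta> where "\<theta> = sqrt (\<sigma> / inner y p)"
  define z where "z = (1 / \<sigma>) *\<^sub>R (\<theta> *\<^sub>R y - b)"
  define F where "F = Finite_Cartesian_Product.mat 1 + outer z p"
  have pos: "\<sigma> > 0" using \<sigma> by (simp add: \<sigma>_def)
  have \<theta>2: "\<theta> * \<theta> = \<sigma> / inner y p"
    using pos yp by (simp add: \<theta>_def)
  have Ft: "Finite_Cartesian_Product.transpose F = Finite_Cartesian_Product.mat 1 + outer p z"
    by (simp add: F_def Finite_Cartesian_Product.vec_eq_iff Finite_Cartesian_Product.transpose_def
        Finite_Cartesian_Product.mat_def outer_def)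
  have pb: "inner p b = \<sigma>" by (simp add: \<sigma>_def b_def)
  have pB: "inner p (B *v w) = inner b w" for w
    by (simp add: b_def symmetric_inner[OF sym])
  have "bfgs_update B p y *v w = (F ** B ** Finite_Cartesian_Product.transpose F) *v w" for w
  proof -
    have "(F ** B ** Finite_Cartesian_Product.transpose F) *v w
        = B *v w + inner z w *\<^sub>R b + (inner b w + inner z w * \<sigma>) *\<^sub>R z"
      unfolding Ft unfolding F_def matrix_vector_mul_assoc[symmetric]
      by (simp add: matrix_vector_mult_add_rdistrib matrix_vector_right_distrib outer_mult_vec
          matrix_vector_mult_scaleR inner_add_right pB pb b_def[symmetric] algebra_simps)
    also have "inner z w = (\<theta> * inner y w - inner b w) / \<sigma>"
      by (simp add: z_def inner_diff_left)
    also have "inner b w + (\<theta> * inner y w - inner b w) / \<sigma> * \<sigma> = \<theta> * inner y w"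
      using pos by simp
    also have "B *v w + ((\<theta> * inner y w - inner b w) / \<sigma>) *\<^sub>R b + (\<theta> * inner y w) *\<^sub>R z
       = B *v w - (inner b w / \<sigma>) *\<^sub>R b + ((\<theta> * \<theta>) * inner y w / \<sigma>) *\<^sub>R y"
      using pos by (simp add: z_def algebra_simps diff_divide_distrib)
    also have "\<dots> = bfgs_update B p y *v w"
      using pos yp by (simp add: bfgs_update_mult_vec \<theta>2 b_def \<sigma>_def)
    finally show ?thesis by simp
  qed
  then have "bfgs_update B p y = F ** B ** Finite_Cartesian_Product.transpose F"
    by (simp add: matrix_eq)
  moreover have "Determinants.det F = \<theta> * inner y p / \<sigma>"
    using pos by (simp add: F_def det_rank_one_update z_def inner_diff_left pb inner_commute[of b p]
        field_simps)
  then have "(Determinants.det F)\<^sup>2 = (\<theta> * \<theta>) * (inner y p)\<^sup>2 / \<sigma>\<^sup>2"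
    by (simp add: power2_eq_square mult_ac)
  then have "(Determinants.det F)\<^sup>2 = inner y p / inner p (B *v p)"
    using pos yp unfolding \<theta>2 by (simp add: power2_eq_square \<sigma>_def[symmetric])
  ultimately show ?thesis using that by blast
qed

lemma pos_def_symmetric: "pos_def B \<Longrightarrow> Finite_Cartesian_Product.transpose B = B"
  by (simp add: pos_def_def)

lemma pos_def_pos: "pos_def B \<Longrightarrow> v \<noteq> 0 \<Longrightarrow> 0 < inner v (B *v v)"
  by (simp add: pos_def_def)

lemma pos_def_mult_nonzero: "pos_def B \<Longrightarrow> v \<noteq> 0 \<Longrightarrow> B *v v \<noteq> 0"
  using pos_def_pos by fastforce

lemma pos_def_det_nonzero:
  assumes "pos_def B"
  shows "Determinants.det B \<noteq> 0"
proof
  assume "Determinants.det B = 0"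
  then have "\<not> invertible B" by (simp add: invertible_det_nz)
  then obtain v where "B *v v = 0" "v \<noteq> 0"
    by (metis invertible_left_inverse matrix_left_invertible_ker)
  then show False using pos_def_mult_nonzero[OF assms] by blast
qed

lemma det_bfgs_update:
  assumes "pos_def B" "p \<noteq> 0" "0 < inner y p"
  shows "Determinants.det (bfgs_update B p y)
    = Determinants.det B * (inner y p / inner p (B *v p))"
proof -
  obtain F where F: "bfgs_update B p y = F ** B ** Finite_Cartesian_Product.transpose F"
    "(Determinants.det F)\<^sup>2 = inner y p / inner p (B *v p)"
    using bfgs_update_congruence[OF pos_def_symmetric pos_def_pos] assms by metis
  then show ?thesis by (simp add: det_mul Determinants.det_transpose power2_eq_square mult_ac)
qed

lemma pos_def_bfgs_update:
  assumes "pos_def B" "p \<noteq> 0" "0 < inner y p"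
  shows "pos_def (bfgs_update B p y)"
proof -
  obtain F where F: "bfgs_update B p y = F ** B ** Finite_Cartesian_Product.transpose F"
    "(Determinants.det F)\<^sup>2 = inner y p / inner p (B *v p)"
    using bfgs_update_congruence[OF pos_def_symmetric pos_def_pos] assms by metis
  have "Determinants.det F \<noteq> 0"
    using F(2) assms pos_def_pos[of B p] by auto
  then have "invertible (Finite_Cartesian_Product.transpose F)"
    by (simp add: invertible_det_nz Determinants.det_transpose)
  then have ker: "Finite_Cartesian_Product.transpose F *v v \<noteq> 0" if "v \<noteq> 0" for v
    using that by (metis invertible_left_inverse matrix_left_invertible_ker)
  have "inner v (bfgs_update B p y *v v) = inner (Finite_Cartesian_Product.transpose F *v v)
      (B *v (Finite_Cartesian_Product.transpose F *v v))" for v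
    unfolding F(1) by (metis dot_lmul_matrix matrix_vector_mul_assoc transpose_matrix_vector)
  then show ?thesis
    using F(1) ker pos_def_pos[OF assms(1)] pos_def_symmetric[OF assms(1)]
    by (simp add: pos_def_def matrix_transpose_mul matrix_mul_assoc)
qed

lemma trace_scaleR: "trace (c *\<^sub>R A) = c * trace A" for A :: "real ^ 'n ^ 'n"
  by (simp add: trace_def sum_distrib_left)

lemma trace_bfgs_update:
  "trace (bfgs_update B p y) = trace B - (norm (B *v p))\<^sup>2 / inner p (B *v p) + (norm y)\<^sup>2 / inner y p"
  by (simp add: bfgs_update_def trace_add trace_sub trace_scaleR trace_outer power2_norm_eq_inner)

section \<open>The merit function\<close>

definition merit :: "real ^ 'n ^ 'n \<Rightarrow> real" where
  "merit B = trace B - ln \<bar>Determinants.det B\<bar>"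

text \<open>
  The squared cosine of the angle between $s$ and $B s$.
\<close>

definition cos2 :: "real ^ 'n ^ 'n \<Rightarrow> real ^ 'n \<Rightarrow> real" where
  "cos2 B s = (inner s (B *v s))\<^sup>2 / ((norm s)\<^sup>2 * (norm (B *v s))\<^sup>2)"

lemma cos2_le_1: "cos2 B s \<le> 1"
proof -
  have "(inner s (B *v s))\<^sup>2 \<le> (norm s * norm (B *v s))\<^sup>2"
    by (metis Cauchy_Schwarz_ineq2 abs_le_square_iff abs_mult abs_norm_cancel)
  then show ?thesis
    by (auto simp: cos2_def divide_le_eq_1 power_mult_distrib zero_less_mult_iff)
qed

lemma cos2_pos:
  assumes "pos_def B" "s \<noteq> 0"
  shows "0 < cos2 B s"
  using assms pos_def_pos[OF assms] pos_def_mult_nonzero[OF assms] by (simp add: cos2_def)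

text \<open>
  A bound for the growth of the merit function in one update, apart from the cosine term, when
  $\eta \|p\|^2 \le y^T p$ and $\|y\| \le M \|p\|$. The absolute value makes it nonnegative without
  a relation between $M$ and $\eta$, so that it can be multiplied by a bound for the number of
  columns.
\<close>

definition growth :: "real \<Rightarrow> real \<Rightarrow> real" where
  "growth M \<eta> = \<bar>M\<^sup>2 / \<eta> - ln \<eta>\<bar>"

text \<open>
  With $u = \|B p\|^2 / p^T B p$ one has $p^T B p = u \cos^2(B, p) \|p\|^2$. The loss $-u$ of trace
  absorbs the gain $\ln u$ in the logarithm since $\ln u \le u - 1$, and what remains is
  $\ln \cos^2(B, p)$ and a constant.
\<close>

lemma merit_bfgs_update:
  assumes B: "pos_def B" and p: "p \<noteq> 0" and \<eta>: "\<eta> > 0"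
    and curv: "\<eta> * (norm p)\<^sup>2 \<le> inner y p" and y: "norm y \<le> M * norm p"
  shows "merit (bfgs_update B p y) \<le> merit B + growth M \<eta> + ln (cos2 B p)"
proof -
  define \<sigma> where "\<sigma> = inner p (B *v p)"
  define u where "u = (norm (B *v p))\<^sup>2 / \<sigma>"
  have \<sigma>: "\<sigma> > 0" using pos_def_pos[OF B p] by (simp add: \<sigma>_def)
  have u: "u > 0" using \<sigma> pos_def_mult_nonzero[OF B p] by (simp add: u_def)
  have pp: "(norm p)\<^sup>2 > 0" using p by simp
  have yp: "inner y p > 0" using curv \<eta> pp by (smt (verit) mult_pos_pos)
  have det: "ln \<bar>Determinants.det (bfgs_update B p y)\<bar>
      = ln \<bar>Determinants.det B\<bar> + ln (inner y p) - ln \<sigma>"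
    using \<sigma> yp pos_def_det_nonzero[OF B]
    by (simp add: det_bfgs_update[OF B p yp] \<sigma>_def[symmetric] abs_mult ln_mult ln_div)
  have "\<sigma> = u * cos2 B p * (norm p)\<^sup>2"
    using \<sigma> p pos_def_mult_nonzero[OF B p]
    by (simp add: u_def cos2_def \<sigma>_def[symmetric] power2_eq_square field_simps)
  then have ln\<sigma>: "ln \<sigma> = ln u + ln (cos2 B p) + ln ((norm p)\<^sup>2)"
    using u cos2_pos[OF B p] pp by (metis ln_mult mult_pos_pos less_numeral_extra(3) order_less_irrefl)
  have "ln u \<le> u - 1" using ln_le_minus_one[OF u] .
  moreover have "ln \<eta> + ln ((norm p)\<^sup>2) \<le> ln (inner y p)"
    using ln_mult_pos[OF \<eta> pp] ln_mono[OF curv] \<eta> pp yp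
    by (metis mult_pos_pos)
  moreover have "(norm y)\<^sup>2 / inner y p \<le> M\<^sup>2 / \<eta>"
  proof -
    have "(norm y)\<^sup>2 \<le> M\<^sup>2 * (norm p)\<^sup>2"
      using y by (metis norm_ge_zero power_mono power_mult_distrib)
    then have "(norm y)\<^sup>2 / inner y p \<le> M\<^sup>2 * (norm p)\<^sup>2 / (\<eta> * (norm p)\<^sup>2)"
      using curv \<eta> pp by (intro frac_le) auto
    then show ?thesis using pp by simp
  qed
  ultimately show ?thesis
    unfolding merit_def growth_def trace_bfgs_update det
    using ln\<sigma> by (simp add: u_def \<sigma>_def)
qed

text \<open>
  The quadratic form at $e_i \pm e_j$ shows $2 |B_{ij}| \le B_{ii} + B_{jj}$.
\<close>

lemma pos_def_entry_le_trace:
  assumes "pos_def B"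
  shows "\<bar>B $ i $ j\<bar> \<le> trace B"
proof -
  have quad: "inner (axis a 1 + c *\<^sub>R axis b 1) (B *v (axis a 1 + c *\<^sub>R axis b 1))
      = B $ a $ a + 2 * c * B $ a $ b + c\<^sup>2 * B $ b $ b" for a b c
  proof -
    have "Finite_Cartesian_Product.transpose B $ a $ b = B $ a $ b"
      using pos_def_symmetric[OF assms] by simp
    then have "B $ b $ a = B $ a $ b"
      by (simp add: Finite_Cartesian_Product.transpose_def)
    moreover have "inner (axis a 1) (B *v axis b 1) = B $ a $ b" for a b
      by (simp add: inner_axis' matrix_vector_mult_basis Finite_Cartesian_Product.column_def)
    ultimately show ?thesis
      by (simp add: inner_add_left inner_add_right matrix_vector_right_distrib
          matrix_vector_mult_scaleR power2_eq_square algebra_simps)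
  qed
  have nonneg: "0 \<le> inner v (B *v v)" for v
    using pos_def_pos[OF assms, of v] by (cases "v = 0") auto
  have diag: "0 \<le> B $ a $ a" for a
    using nonneg[of "axis a 1"] quad[of a 0 a] by simp
  have diag_le: "B $ a $ a \<le> trace B" for a
    unfolding trace_def by (rule member_le_sum) (auto simp: diag)
  have "0 \<le> B $ i $ i + 2 * 1 * B $ i $ j + 1\<^sup>2 * B $ j $ j"
    using quad[of i 1 j] nonneg by metis
  moreover have "0 \<le> B $ i $ i + 2 * (-1) * B $ i $ j + (-1)\<^sup>2 * B $ j $ j"
    using quad[of i "-1" j] nonneg by metis
  ultimately show ?thesis using diag_le[of i] diag_le[of j] by auto
qed

text \<open>
  By the Leibniz formula and the bound on the entries, $|\det B| \le n!\, T^n$ with $T$ the trace of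
  $B$, and $T - n \ln T$ is bounded below for $T > 0$.
\<close>

lemma merit_bounded_below:
  obtains c where "\<And>B :: real ^ 'n ^ 'n. pos_def B \<Longrightarrow> c \<le> merit B"
proof -
  define n where "n = CARD('n)"
  have n: "n > 0" by (simp add: n_def)
  have "real n - real n * ln (real n) - ln (fact n) \<le> merit B" if B: "pos_def B" for B :: "real ^ 'n ^ 'n"
  proof -
    define T where "T = trace B"
    have "\<bar>Determinants.det B\<bar> \<le> (\<Sum>p\<in>{p. p permutes (UNIV::'n set)}. \<bar>of_int (sign p) * (\<Prod>i\<in>UNIV. B $ i $ p i)\<bar>)"
      unfolding Determinants.det_def by (rule sum_abs)
    also have "\<dots> \<le> (\<Sum>p\<in>{p. p permutes (UNIV::'n set)}. T ^ n)"
    proof (rule sum_mono)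
      fix p :: "'n \<Rightarrow> 'n"
      have "(\<Prod>i\<in>UNIV. \<bar>B $ i $ p i\<bar>) \<le> (\<Prod>i\<in>(UNIV::'n set). T)"
        by (rule prod_mono) (auto simp: T_def pos_def_entry_le_trace[OF B])
      then show "\<bar>of_int (sign p) * (\<Prod>i\<in>UNIV. B $ i $ p i)\<bar> \<le> T ^ n"
        by (simp add: abs_mult abs_prod n_def sign_def)
    qed
    also have "\<dots> = fact n * T ^ n"
      by (simp add: card_permutations n_def)
    finally have det: "\<bar>Determinants.det B\<bar> \<le> fact n * T ^ n" .
    have "T \<ge> 0" using pos_def_entry_le_trace[OF B] unfolding T_def by (meson abs_ge_zero order_trans)
    moreover have "T \<noteq> 0" using det pos_def_det_nonzero[OF B] n by (auto simp: power_0_left)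
    ultimately have T: "T > 0" by simp
    have "ln \<bar>Determinants.det B\<bar> \<le> ln (fact n * T ^ n)"
      using det pos_def_det_nonzero[OF B] T by (subst ln_le_cancel_iff) auto
    also have "\<dots> = ln (fact n) + n * ln T"
      using T by (simp add: ln_mult ln_realpow)
    also have "n * ln T \<le> T - n + n * ln n"
    proof -
      have "ln (T / n) \<le> T / n - 1" using T n by (intro ln_le_minus_one) auto
      then have "n * ln (T / n) \<le> n * (T / n - 1)" by (intro mult_left_mono) auto
      then show ?thesis using T n by (simp add: ln_div algebra_simps)
    qed
    finally show ?thesis by (simp add: merit_def T_def)
  qed
  then show ?thesis using that by blast
qed

text \<open>
  The update with the pair $(s, s)$ has curvature constants $\eta = M = 1$, and it cannot push the
  merit function below its lower bound.
\<close>

lemma ln_cos2_lower_bound: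
  obtains c where "\<And>(B :: real ^ 'n ^ 'n) s. pos_def B \<Longrightarrow> s \<noteq> 0 \<Longrightarrow> c - merit B \<le> ln (cos2 B s)"
proof -
  obtain c where c: "\<And>B :: real ^ 'n ^ 'n. pos_def B \<Longrightarrow> c \<le> merit B"
    using merit_bounded_below by blast
  have "c - growth 1 1 - merit B \<le> ln (cos2 B s)" if B: "pos_def B" and s: "s \<noteq> 0"
    for B :: "real ^ 'n ^ 'n" and s
  proof -
    have "c \<le> merit (bfgs_update B s s)"
      using c pos_def_bfgs_update[OF B s] s by simp
    then show ?thesis
      using merit_bfgs_update[OF B s, of 1 s 1] by (simp add: power2_norm_eq_inner)
  qed
  then show ?thesis using that by blast
qed

section \<open>Block terms as projections\<close>

text \<open>
  The columns of \<open>D\<close> are linearly independent and the quadratic form of \<open>A\<close> is positive on their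
  span; for symmetric \<open>A\<close> this says that $D^T A D$ is positive definite. The form of \<open>A\<close> may be indefinite elsewhere.
\<close>

definition definite_on :: "real ^ 'n ^ 'n \<Rightarrow> (real ^ 'n) list \<Rightarrow> bool" where
  "definite_on A D \<longleftrightarrow> distinct D \<and> independent (set D) \<and>
     (\<forall>v \<in> span (set D). v \<noteq> 0 \<longrightarrow> 0 < inner v (A *v v))"

lemma definite_on_pos: "definite_on A D \<Longrightarrow> v \<in> span (set D) \<Longrightarrow> v \<noteq> 0 \<Longrightarrow> 0 < inner v (A *v v)"
  by (simp add: definite_on_def)

lemma definite_on_append: "definite_on A (D @ E) \<Longrightarrow> definite_on A D"
  unfolding definite_on_def
  by (metis Un_upper1 distinct_append independent_mono set_append span_mono subsetD)

lemma definite_on_pos_def: "definite_on A D \<Longrightarrow> pos_def B \<Longrightarrow> definite_on B D"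
  by (simp add: definite_on_def pos_def_def)

lemma sum_nth_distinct:
  assumes "distinct D"
  shows "(\<Sum>i<length D. h (D ! i)) = (\<Sum>d\<in>set D. h d)"
  using sum.reindex_bij_betw[OF bij_betw_nth[OF assms refl refl]] by blast

lemma span_set_coefficients:
  fixes D :: "(real ^ 'n) list"
  assumes "distinct D" "v \<in> span (set D)"
  obtains c where "v = (\<Sum>i<length D. c i *\<^sub>R D ! i)"
proof -
  obtain u where "v = (\<Sum>d\<in>set D. u d *\<^sub>R d)"
    using assms(2) by (auto simp: span_finite)
  then have "v = (\<Sum>i<length D. u (D ! i) *\<^sub>R D ! i)"
    by (simp add: sum_nth_distinct[OF assms(1), of "\<lambda>d. u d *\<^sub>R d"])
  then show ?thesis using that[of "\<lambda>i. u (D ! i)"] by simp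
qed

lemma sum_nth_in_span: "(\<Sum>i<length D. c i *\<^sub>R D ! i) \<in> span (set D)" for D :: "(real ^ 'n) list"
  by (intro span_sum span_scale span_base) auto

lemma independent_coefficients:
  fixes D :: "(real ^ 'n) list"
  assumes "distinct D" "independent (set D)" "(\<Sum>i<length D. c i *\<^sub>R D ! i) = 0" "i < length D"
  shows "c i = 0"
proof -
  define u where "u d = c (inv_into {..<length D} ((!) D) d)" for d
  have inj: "inj_on ((!) D) {..<length D}"
    using assms(1) by (simp add: inj_on_nth)
  have u: "u (D ! j) = c j" if "j < length D" for j
    using inv_into_f_f[OF inj] that by (simp add: u_def)
  have "(\<Sum>d\<in>set D. u d *\<^sub>R d) = (\<Sum>i<length D. c i *\<^sub>R D ! i)"
    by (simp add: sum_nth_distinct[OF assms(1), symmetric] u)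
  then have "u (D ! i) = 0"
    using assms by (intro independentD[of "set D" "set D" u]) auto
  then show ?thesis using u assms(4) by simp
qed

lemma matrix_vector_mult_sum_left: "(\<Sum>i\<in>I. F i) *v w = (\<Sum>i\<in>I. F i *v w)"
  for F :: "nat \<Rightarrow> real ^ 'n ^ 'm"
  by (induction I rule: infinite_finite_induct) (simp_all add: matrix_vector_mult_add_rdistrib)

lemma matrix_vector_mult_sum_right: "A *v (\<Sum>i\<in>I. F i) = (\<Sum>i\<in>I. A *v F i)"
  for F :: "nat \<Rightarrow> real ^ 'n" and A :: "real ^ 'n ^ 'm"
  by (induction I rule: infinite_finite_induct) (simp_all add: matrix_vector_right_distrib)

lemma congr_mult_vec:
  assumes "i < length D"
  shows "vec_index (mult_mat_vec (congr D A) (Matrix.vec (length D) c)) i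
    = inner (D ! i) (A *v (\<Sum>j<length D. c j *\<^sub>R D ! j))"
  using assms
  by (simp add: congr_def scalar_prod_def inner_sum_right matrix_vector_mult_scaleR
      lessThan_atLeast0 mult.commute Matrix.row_def matrix_vector_mult_sum_right)

lemma congr_quadratic:
  "scalar_prod (Matrix.vec (length D) c) (mult_mat_vec (congr D A) (Matrix.vec (length D) c))
    = inner (\<Sum>j<length D. c j *\<^sub>R D ! j) (A *v (\<Sum>j<length D. c j *\<^sub>R D ! j))"
proof -
  have "dim_vec (mult_mat_vec (congr D A) (Matrix.vec (length D) c)) = length D"
    by (simp add: congr_def)
  then show ?thesis
    by (simp add: scalar_prod_def congr_mult_vec inner_sum_left lessThan_atLeast0 del: index_mult_mat_vec)
qed

lemma congr_inverse:
  assumes D: "definite_on A D"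
  obtains C where "mat_inverse (congr D A) = Some C" "C \<in> carrier_mat (length D) (length D)"
    "congr D A * C = 1\<^sub>m (length D)" "C * congr D A = 1\<^sub>m (length D)"
proof -
  let ?m = "length D"
  have carrier: "congr D A \<in> carrier_mat ?m ?m" by (simp add: congr_def)
  have "Determinant.det (congr D A) \<noteq> 0"
  proof
    assume "Determinant.det (congr D A) = 0"
    then obtain v where v: "v \<in> carrier_vec ?m" "v \<noteq> 0\<^sub>v ?m" "mult_mat_vec (congr D A) v = 0\<^sub>v ?m"
      using det_0_iff_vec_prod_zero_field[OF carrier] by blast
    define c where "c = vec_index v"
    define w where "w = (\<Sum>j<?m. c j *\<^sub>R D ! j)"
    have v_eq: "v = Matrix.vec ?m c" using v(1) by (auto simp: c_def)
    have "inner w (A *v w) = 0"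
      using congr_quadratic[of D c A] v(3) unfolding w_def v_eq[symmetric]
      using v(1) by simp
    then have "w = 0"
      using definite_on_pos[OF D] sum_nth_in_span[of c D] unfolding w_def by fastforce
    then have "c i = 0" if "i < ?m" for i
      using independent_coefficients[of D c i] D that by (simp add: w_def definite_on_def)
    then show False using v(1,2) by (auto simp: v_eq)
  qed
  then have "congr D A \<in> Units (ring_mat TYPE(real) ?m ())"
    by (rule det_non_zero_imp_unit[OF carrier])
  then obtain C where "mat_inverse (congr D A) = Some C"
    using mat_inverse(1)[OF carrier] by (metis not_Some_eq)
  then show ?thesis using that mat_inverse(2)[OF carrier] by blast
qed

lemma invertible_congr:
  assumes "definite_on A D"
  shows "invertible_mat (congr D A)"
proof -
  obtain C where C: "C \<in> carrier_mat (length D) (length D)"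
    "congr D A * C = 1\<^sub>m (length D)" "C * congr D A = 1\<^sub>m (length D)"
    using congr_inverse[OF assms] by metis
  then show ?thesis
    unfolding invertible_mat_def inverts_mat_def by (auto simp: congr_def intro!: exI[of _ C])
qed

lemma spread_mult_vec:
  "spread D C *v w = (\<Sum>i<length D. (\<Sum>j<length D. index_mat C (i, j) * inner (D ! j) w) *\<^sub>R D ! i)"
  by (simp only: spread_def outer_def[symmetric] matrix_vector_mult_sum_left
      scaleR_matrix_vector_assoc[symmetric] outer_mult_vec scaleR_sum_left scaleR_scaleR)

text \<open>
  The vector \<open>x\<close> is the \<open>A\<close>-orthogonal projection of \<open>v\<close> onto the span of \<open>D\<close>: its coefficients
  $(D^T A D)^{-1} D^T A v$ solve the normal equations.
\<close>

lemma block_term_mult_vec: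
  assumes D: "definite_on A D"
  obtains x where "x \<in> span (set D)" "block_term A D *v v = A *v x"
    "\<And>d. d \<in> set D \<Longrightarrow> inner d (A *v (v - x)) = 0"
proof -
  let ?m = "length D"
  obtain C where C: "mat_inverse (congr D A) = Some C" "C \<in> carrier_mat ?m ?m"
    "congr D A * C = 1\<^sub>m ?m"
    using congr_inverse[OF D] by metis
  define h where "h j = inner (D ! j) (A *v v)" for j
  define c where "c i = (\<Sum>j<?m. index_mat C (i, j) * h j)" for i
  define x where "x = (\<Sum>i<?m. c i *\<^sub>R D ! i)"
  have x: "x = spread D C *v (A *v v)"
    by (simp add: x_def c_def h_def spread_mult_vec)
  have "block_term A D *v v = A *v x"
    by (simp add: block_term_def C(1) x matrix_vector_mul_assoc matrix_mul_assoc)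
  moreover have "inner (D ! k) (A *v x) = inner (D ! k) (A *v v)" if k: "k < ?m" for k
  proof -
    have c_vec: "Matrix.vec ?m c = mult_mat_vec C (Matrix.vec ?m h)"
      using C(2) by (auto simp: c_def scalar_prod_def lessThan_atLeast0 Matrix.row_def)
    have "inner (D ! k) (A *v x) = vec_index (mult_mat_vec (congr D A) (Matrix.vec ?m c)) k"
      by (simp add: congr_mult_vec[OF k] x_def)
    also have "mult_mat_vec (congr D A) (Matrix.vec ?m c) = Matrix.vec ?m h"
      unfolding c_vec using C(2,3)
      by (subst assoc_mult_mat_vec[symmetric, of _ ?m ?m _ ?m]) (auto simp: congr_def)
    finally show ?thesis using k by (simp add: h_def)
  qed
  then have "inner d (A *v (v - x)) = 0" if "d \<in> set D" for d
    using that by (auto simp: in_set_conv_nth matrix_vector_mult_diff_distrib inner_diff_right)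
  ultimately show ?thesis
    using that sum_nth_in_span[of c D] by (simp add: x_def)
qed

lemma inner_span_zero:
  assumes "\<And>d. d \<in> S \<Longrightarrow> inner d w = 0" "v \<in> span S"
  shows "inner v w = 0"
proof -
  have "span S \<subseteq> {v. inner v w = 0}"
    by (rule span_minimal) (use assms(1) in \<open>auto simp: subspace_def inner_add_left\<close>)
  then show ?thesis using assms(2) by blast
qed

text \<open>
  The \<open>A\<close>-orthogonal projection onto a subspace where \<open>A\<close> is positive definite is unique, so the
  properties of \<open>block_term_mult_vec\<close> determine the block term.
\<close>

lemma block_term_mult_vec_unique:
  assumes D: "definite_on A D" and x: "x \<in> span (set D)"
    and orth: "\<And>d. d \<in> set D \<Longrightarrow> inner d (A *v (v - x)) = 0"
  shows "block_term A D *v v = A *v x"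
proof -
  obtain x' where x': "x' \<in> span (set D)" "block_term A D *v v = A *v x'"
    "\<And>d. d \<in> set D \<Longrightarrow> inner d (A *v (v - x')) = 0"
    using block_term_mult_vec[OF D] by blast
  have "inner d (A *v (x - x')) = 0" if "d \<in> set D" for d
    using orth[OF that] x'(3)[OF that] by (simp add: matrix_vector_mult_diff_distrib inner_diff_right)
  then have "inner (x - x') (A *v (x - x')) = 0"
    by (rule inner_span_zero[OF _ span_diff[OF x x'(1)]])
  then have "x = x'"
    using definite_on_pos[OF D span_diff[OF x x'(1)]] by force
  then show ?thesis using x'(2) by simp
qed

lemma span_snoc_mono: "x \<in> span (set D) \<Longrightarrow> x \<in> span (set (D @ [s]))" for s :: "real ^ 'n"
  by (rule subsetD[OF span_mono]) auto

lemma diff_in_span_snoc: "x \<in> span (set D) \<Longrightarrow> s - x \<in> span (set (D @ [s]))" for s :: "real ^ 'n"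
  by (rule span_diff[OF span_base span_snoc_mono]) simp_all

lemma definite_on_snoc_notin_span:
  assumes "definite_on A (D @ [s])"
  shows "s \<notin> span (set D)"
proof -
  have "s \<notin> set D" "independent (insert s (set D))"
    using assms by (auto simp: definite_on_def)
  then show ?thesis using independent_insert[of s "set D"] by metis
qed

text \<open>
  With \<open>r\<close> the \<open>A\<close>-orthogonal part of \<open>s\<close>, the projection onto the larger span is the sum of the
  projections onto the span of \<open>D\<close> and onto the line of \<open>r\<close>.
\<close>

lemma block_term_snoc:
  assumes sym: "Finite_Cartesian_Product.transpose A = A" and D: "definite_on A (D @ [s])"
    and x: "x \<in> span (set D)" and r: "r = s - x"
    and orth: "\<And>d. d \<in> set D \<Longrightarrow> inner d (A *v r) = 0"
  shows "block_term A (D @ [s]) *v v = block_term A D *v v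
    + (inner (A *v r) v / inner r (A *v r)) *\<^sub>R (A *v r)"
proof -
  have D': "definite_on A D" using definite_on_append[OF D] .
  obtain y where y: "y \<in> span (set D)" "block_term A D *v v = A *v y"
    "\<And>d. d \<in> set D \<Longrightarrow> inner d (A *v (v - y)) = 0"
    using block_term_mult_vec[OF D'] by blast
  have mono: "u \<in> span (set D) \<Longrightarrow> u \<in> span (set (D @ [s]))" for u
    using span_snoc_mono .
  have r_span: "r \<in> span (set (D @ [s]))"
    unfolding r using diff_in_span_snoc[OF x] .
  have "s \<notin> span (set D)" using definite_on_snoc_notin_span[OF D] .
  then have "r \<noteq> 0" using x r by auto
  then have rr: "inner r (A *v r) > 0" using definite_on_pos[OF D r_span] by simp
  define t where "t = inner (A *v r) v / inner r (A *v r)"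
  have t: "t * inner r (A *v r) = inner r (A *v v)"
    using rr by (simp add: t_def symmetric_inner[OF sym])
  have "block_term A (D @ [s]) *v v = A *v (y + t *\<^sub>R r)"
  proof (rule block_term_mult_vec_unique[OF D])
    show "y + t *\<^sub>R r \<in> span (set (D @ [s]))"
      using mono[OF y(1)] r_span by (intro span_add span_scale) auto
    have expand: "inner d (A *v (v - (y + t *\<^sub>R r)))
        = inner d (A *v (v - y)) - t * inner d (A *v r)" for d
      by (simp add: matrix_vector_mult_diff_distrib matrix_vector_right_distrib
          matrix_vector_mult_scaleR algebra_simps)
    have in_D: "inner d (A *v (v - (y + t *\<^sub>R r))) = 0" if "d \<in> set D" for d
      using y(3) orth that by (simp add: expand)
    have "inner r (A *v y) = 0"
      using inner_span_zero[of "set D" "A *v r" y] orth y(1) symmetric_inner[OF sym, of r y]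
      by (metis inner_commute)
    then have "inner r (A *v (v - (y + t *\<^sub>R r))) = 0"
      unfolding expand using t by (simp add: matrix_vector_mult_diff_distrib inner_diff_right)
    moreover have "inner x (A *v (v - (y + t *\<^sub>R r))) = 0"
      using inner_span_zero[of "set D" _ x] in_D x by blast
    ultimately have "inner s (A *v (v - (y + t *\<^sub>R r))) = 0"
      using r by (simp add: inner_diff_left)
    then show "inner d (A *v (v - (y + t *\<^sub>R r))) = 0" if "d \<in> set (D @ [s])" for d
      using in_D that by auto
  qed
  then show ?thesis
    by (simp add: y(2) matrix_vector_right_distrib matrix_vector_mult_scaleR t_def)
qed

lemma block_update_mult_vec:
  fixes B Gt :: "real ^ 'n ^ 'n"
  shows "block_update B Gt D *v w = B *v w - block_term B D *v w + block_term Gt D *v w"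
proof -
  have "block_term A [] = 0" for A :: "real ^ 'n ^ 'n"
    by (simp add: block_term_def spread_def)
  then show ?thesis
    by (cases "D = []") (simp_all add: block_update_def matrix_vector_mult_add_rdistrib
        matrix_vector_mult_diff_rdistrib)
qed

text \<open>
  Let \<open>p\<close> be the part of \<open>s\<close> that is \<open>Gt\<close>-orthogonal to the span of \<open>D\<close>, and \<open>r\<close> the part that is
  \<open>B\<close>-orthogonal to it. They differ by an element of the span. The block update by \<open>D\<close> maps \<open>p\<close> to
  \<open>B *v r\<close>: its \<open>Gt\<close>-term vanishes at \<open>p\<close>, and its \<open>B\<close>-terms leave the \<open>B\<close>-orthogonal part. So the
  rank-one term that BFGS subtracts is the term by which the block term of \<open>B\<close> grows, and the term
  that it adds is the one by which the block term of \<open>Gt\<close> grows.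
\<close>

lemma block_update_snoc:
  assumes B: "pos_def B" and Gt: "Finite_Cartesian_Product.transpose Gt = Gt"
    and D: "definite_on Gt (D @ [s])"
  obtains p where "p \<in> span (set (D @ [s]))" "p \<noteq> 0" "D = [] \<Longrightarrow> p = s"
    "block_update B Gt (D @ [s]) = bfgs_update (block_update B Gt D) p (Gt *v p)"
proof -
  have D': "definite_on Gt D" using definite_on_append[OF D] .
  obtain x where x: "x \<in> span (set D)" "\<And>d. d \<in> set D \<Longrightarrow> inner d (Gt *v (s - x)) = 0"
    using block_term_mult_vec[OF D'] by blast
  define p where "p = s - x"
  obtain y where y: "y \<in> span (set D)" "block_term B D *v p = B *v y"
      "\<And>d. d \<in> set D \<Longrightarrow> inner d (B *v (p - y)) = 0"
    using block_term_mult_vec[OF definite_on_pos_def[OF D' B]] by blast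
  define r where "r = p - y"
  have orth_p: "inner d (Gt *v p) = 0" if "d \<in> set D" for d
    using x(2)[OF that] by (simp add: p_def)
  have orth_r: "inner d (B *v r) = 0" if "d \<in> set D" for d
    using y(3)[OF that] by (simp add: r_def)
  have Gp: "block_term Gt D *v p = 0"
    using block_term_mult_vec_unique[OF D', of 0 p] orth_p by (simp add: span_zero)
  have p_span: "p \<in> span (set (D @ [s]))"
    unfolding p_def using diff_in_span_snoc[OF x(1)] .
  have "s \<notin> span (set D)" using definite_on_snoc_notin_span[OF D] .
  then have p0: "p \<noteq> 0" using x(1) by (auto simp: p_def)
  have hat: "block_update B Gt D *v p = B *v r"
    by (simp add: block_update_mult_vec Gp y(2) r_def matrix_vector_mult_diff_distrib)
  have "inner y (B *v r) = 0"
    using inner_span_zero[of "set D" "B *v r" y] orth_r y(1) by blast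
  then have pr: "inner p (B *v r) = inner r (B *v r)"
    by (simp add: r_def inner_diff_left)
  have "block_update B Gt (D @ [s]) *v w = bfgs_update (block_update B Gt D) p (Gt *v p) *v w" for w
  proof -
    have "block_term Gt (D @ [s]) *v w = block_term Gt D *v w
        + (inner (Gt *v p) w / inner p (Gt *v p)) *\<^sub>R (Gt *v p)"
      by (rule block_term_snoc[OF Gt D x(1) p_def]) (rule orth_p)
    moreover have "block_term B (D @ [s]) *v w = block_term B D *v w
        + (inner (B *v r) w / inner r (B *v r)) *\<^sub>R (B *v r)"
      by (rule block_term_snoc[OF pos_def_symmetric[OF B] definite_on_pos_def[OF D B], of "x + y"])
        (use x(1) y(1) orth_r in \<open>auto simp: r_def p_def span_add\<close>)
    ultimately show ?thesis
      unfolding bfgs_update_mult_vec hat pr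
      by (simp add: block_update_mult_vec inner_commute[of p "Gt *v p"] algebra_simps)
  qed
  then have "block_update B Gt (D @ [s]) = bfgs_update (block_update B Gt D) p (Gt *v p)"
    by (simp add: matrix_eq)
  moreover have "p = s" if "D = []" using that x(1) by (simp add: p_def)
  ultimately show ?thesis using that p_span p0 by blast
qed

lemma pos_def_block_update:
  assumes B: "pos_def B" and Gt: "Finite_Cartesian_Product.transpose Gt = Gt"
    and D: "definite_on Gt D"
  shows "pos_def (block_update B Gt D)"
  using D
proof (induction D rule: rev_induct)
  case Nil
  then show ?case using B by (simp add: block_update_def)
next
  case (snoc s D)
  obtain p where p: "p \<in> span (set (D @ [s]))" "p \<noteq> 0"
    "block_update B Gt (D @ [s]) = bfgs_update (block_update B Gt D) p (Gt *v p)"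
    using block_update_snoc[OF B Gt snoc.prems] by metis
  then show ?case
    using pos_def_bfgs_update[OF snoc.IH p(2)] definite_on_append[OF snoc.prems]
      definite_on_pos[OF snoc.prems p(1,2)] by (simp add: inner_commute)
qed

text \<open>
  Only the first column contributes a cosine: for it the conjugate direction is the column itself
  and the matrix is still \<open>B\<close>. The cosine terms of the later updates, with respect to the
  intermediate matrices, are at most zero and are dropped.
\<close>

lemma merit_block_update:
  assumes B: "pos_def B" and Gt: "Finite_Cartesian_Product.transpose Gt = Gt"
    and D: "definite_on Gt D" and \<eta>: "\<eta> > 0"
    and curv: "\<And>v. v \<in> span (set D) \<Longrightarrow> \<eta> * (norm v)\<^sup>2 \<le> inner v (Gt *v v)"
    and M: "\<And>v. norm (Gt *v v) \<le> M * norm v"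
  shows "merit (block_update B Gt D)
    \<le> merit B + length D * growth M \<eta> + (if D = [] then 0 else ln (cos2 B (hd D)))"
  using D curv
proof (induction D rule: rev_induct)
  case Nil
  then show ?case by (simp add: block_update_def)
next
  case (snoc s D)
  obtain p where p: "p \<in> span (set (D @ [s]))" "p \<noteq> 0" "D = [] \<Longrightarrow> p = s"
    "block_update B Gt (D @ [s]) = bfgs_update (block_update B Gt D) p (Gt *v p)"
    using block_update_snoc[OF B Gt snoc.prems(1)] by metis
  have D: "definite_on Gt D" using definite_on_append[OF snoc.prems(1)] .
  have pd: "pos_def (block_update B Gt D)" using pos_def_block_update[OF B Gt D] .
  have IH: "merit (block_update B Gt D)
      \<le> merit B + length D * growth M \<eta> + (if D = [] then 0 else ln (cos2 B (hd D)))"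
  proof (rule snoc.IH[OF D])
    show "\<eta> * (norm v)\<^sup>2 \<le> inner v (Gt *v v)" if "v \<in> span (set D)" for v
      using that span_mono[of "set D" "set (D @ [s])"] by (intro snoc.prems(2)) auto
  qed
  have "merit (block_update B Gt (D @ [s]))
      \<le> merit (block_update B Gt D) + growth M \<eta> + ln (cos2 (block_update B Gt D) p)"
    unfolding p(4) using snoc.prems(2)[OF p(1)]
    by (intro merit_bfgs_update[OF pd p(2) \<eta> _ M]) (simp add: inner_commute)
  moreover have "ln (cos2 (block_update B Gt D) p) \<le> 0"
    using cos2_le_1 cos2_pos[OF pd p(2)] by simp
  ultimately show ?case
    using IH p(3) by (cases "D = []") (auto simp: block_update_def algebra_simps)
qed

section \<open>Filtered columns\<close>

text \<open>
  The value \<open>sigma2 A D s\<close> is the quadratic form at the \<open>A\<close>-orthogonal part \<open>r\<close> of \<open>s\<close>, and on the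
  larger span the form splits into its values at the component in the span of \<open>D\<close> and at the
  multiple of \<open>r\<close>.
\<close>

lemma definite_on_snoc:
  assumes sym: "Finite_Cartesian_Product.transpose A = A" and D: "definite_on A D"
    and pos: "sigma2 A D s > 0"
  shows "definite_on A (D @ [s])"
proof -
  obtain x where x: "x \<in> span (set D)" "block_term A D *v s = A *v x"
    "\<And>d. d \<in> set D \<Longrightarrow> inner d (A *v (s - x)) = 0"
    using block_term_mult_vec[OF D] by blast
  define r where "r = s - x"
  have orth: "inner u (A *v r) = 0" if "u \<in> span (set D)" for u
    using inner_span_zero[of "set D" "A *v r" u] x(3) that by (simp add: r_def)
  have "sigma2 A D s = inner s (A *v r)"
    by (simp add: sigma2_def x(2) r_def matrix_vector_mult_diff_distrib inner_diff_right)
  also have "\<dots> = inner r (A *v r)"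
    using orth[OF x(1)] by (simp add: r_def inner_diff_left)
  finally have rr: "inner r (A *v r) > 0" using pos by simp
  have s: "s \<notin> span (set D)"
  proof
    assume "s \<in> span (set D)"
    then have "inner r (A *v r) = 0" using x(1) by (intro orth) (simp add: r_def span_diff)
    then show False using rr by simp
  qed
  have "0 < inner v (A *v v)" if v: "v \<in> span (set (D @ [s]))" "v \<noteq> 0" for v
  proof -
    obtain c where "v - c *\<^sub>R s \<in> span (set D)"
      using v(1) by (auto simp: span_insert)
    then have "v - c *\<^sub>R s + c *\<^sub>R x \<in> span (set D)"
      using x(1) by (intro span_add span_scale)
    moreover have "v = (v - c *\<^sub>R s + c *\<^sub>R x) + c *\<^sub>R r"
      by (simp add: r_def scaleR_right_diff_distrib)
    ultimately obtain u where u: "u \<in> span (set D)" "v = u + c *\<^sub>R r"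
      by blast
    have "inner r (A *v u) = 0"
      using orth[OF u(1)] by (metis sym symmetric_inner inner_commute)
    then have quad: "inner v (A *v v) = inner u (A *v u) + c\<^sup>2 * inner r (A *v r)"
      using orth[OF u(1)]
      by (simp add: u(2) inner_add_left inner_add_right matrix_vector_right_distrib
          matrix_vector_mult_scaleR power2_eq_square)
    show ?thesis
    proof (cases "u = 0")
      case True
      then show ?thesis using quad rr u(2) v(2) by auto
    next
      case False
      then show ?thesis using quad rr definite_on_pos[OF D u(1)] by (simp add: add_pos_nonneg)
    qed
  qed
  moreover have "s \<notin> set D" using s span_base by blast
  ultimately show ?thesis
    using D s by (auto simp: definite_on_def independent_insert)
qed

lemma definite_on_filter_from:
  assumes "Finite_Cartesian_Product.transpose Gt = Gt" "\<tau> > 0"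
    and "definite_on Gt D" "0 \<notin> set S"
  shows "definite_on Gt (filter_from \<tau> Gt D S)"
  using assms(3,4)
proof (induction S arbitrary: D)
  case (Cons s S)
  have "0 < \<tau> * (norm s)\<^sup>2" using Cons.prems(2) assms(2) by auto
  then show ?case
    using Cons definite_on_snoc[OF assms(1) Cons.prems(1), of s] by auto
qed simp

lemma definite_on_filter_steps:
  assumes "Finite_Cartesian_Product.transpose Gt = Gt" "\<tau> > 0" "0 \<notin> set S"
  shows "definite_on Gt (filter_steps \<tau> S Gt)"
proof -
  have "definite_on Gt []" using real_vector.independent_empty by (simp add: definite_on_def)
  then show ?thesis
    unfolding filter_steps_def using definite_on_filter_from[OF assms(1,2) _ assms(3)] by blast
qed

lemma set_filter_from: "set (filter_from \<tau> Gt D S) \<subseteq> set D \<union> set S"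
proof (induction S arbitrary: D)
  case (Cons s S)
  show ?case
    using Cons[of "if sigma2 Gt D s \<ge> \<tau> * (norm s)\<^sup>2 then D @ [s] else D"]
    by (auto split: if_splits)
qed simp

lemma length_filter_from: "length (filter_from \<tau> Gt D S) \<le> length D + length S"
proof (induction S arbitrary: D)
  case (Cons s S)
  show ?case
    using Cons[of "if sigma2 Gt D s \<ge> \<tau> * (norm s)\<^sup>2 then D @ [s] else D"]
    by (auto split: if_splits)
qed simp

lemma id_matrix_mult_vec: "id_matrix *v v = v"
  by (simp add: id_matrix_def)

lemma loewner_quadratic: "A \<preceq>\<^sub>L B \<Longrightarrow> inner v (A *v v) \<le> inner v (B *v v)"
  unfolding loewner_le_def psd_def
  by (metis diff_ge_0_iff_ge inner_diff_right matrix_vector_mult_diff_rdistrib)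

lemma loewner_bounds_quadratic:
  assumes "- (M *\<^sub>R id_matrix) \<preceq>\<^sub>L A" "A \<preceq>\<^sub>L M *\<^sub>R id_matrix"
  shows "\<bar>inner v (A *v v)\<bar> \<le> M * (norm v)\<^sup>2"
proof -
  have "- (M *\<^sub>R id_matrix) *v v = - (M *\<^sub>R v)"
    using scaleR_matrix_vector_assoc[of "- M" id_matrix v] by (simp add: id_matrix_mult_vec)
  moreover have "M *\<^sub>R id_matrix *v v = M *\<^sub>R v"
    using scaleR_matrix_vector_assoc[of M id_matrix v] by (simp add: id_matrix_mult_vec)
  ultimately show ?thesis
    using loewner_quadratic[OF assms(1), of v] loewner_quadratic[OF assms(2), of v]
    by (simp add: power2_norm_eq_inner)
qed

text \<open>
  By polarisation the bilinear form of \<open>A\<close> at $u$ and $v$ is at most $M \|v\|^2$ if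
  $\|u\| = \|v\|$; take $u$ in the direction of $A v$.
\<close>

lemma symmetric_norm_bound:
  fixes A :: "real ^ 'n ^ 'n"
  assumes sym: "Finite_Cartesian_Product.transpose A = A"
    and quad: "\<And>v. \<bar>inner v (A *v v)\<bar> \<le> M * (norm v)\<^sup>2"
  shows "norm (A *v v) \<le> M * norm v"
proof (cases "A *v v = 0 \<or> v = 0")
  case True
  have "0 \<le> M * norm v"
  proof (cases "v = 0")
    case False
    have "0 \<le> M * (norm v)\<^sup>2" using quad[of v] by linarith
    then show ?thesis using False by (simp add: zero_le_mult_iff)
  qed simp
  then show ?thesis using True by auto
next
  case False
  define c where "c = norm v / norm (A *v v)"
  define u where "u = c *\<^sub>R (A *v v)"
  have nu: "norm u = norm v" using False by (simp add: u_def c_def)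
  have "inner u (A *v v) = norm v * norm (A *v v)"
    using False by (simp add: u_def c_def power2_norm_eq_inner[symmetric] power2_eq_square)
  moreover have "4 * inner u (A *v v) = inner (u + v) (A *v (u + v)) - inner (u - v) (A *v (u - v))"
    using symmetric_inner[OF sym, of u v]
    by (simp add: inner_add_left inner_add_right inner_diff_left inner_diff_right inner_commute
        matrix_vector_right_distrib matrix_vector_mult_diff_distrib)
  moreover have "\<dots> \<le> M * (norm (u + v))\<^sup>2 + M * (norm (u - v))\<^sup>2"
    using quad[of "u + v"] quad[of "u - v"] by linarith
  moreover have "\<dots> = M * (2 * (norm u)\<^sup>2 + 2 * (norm v)\<^sup>2)"
    by (simp add: power2_norm_eq_inner inner_add_left inner_add_right inner_diff_left
        inner_diff_right algebra_simps)
  ultimately have "norm v * norm (A *v v) \<le> norm v * (M * norm v)"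
    using nu by (simp add: power2_eq_square mult_ac)
  then show ?thesis using False by simp
qed

text \<open>
  An order relation between matrices of order $m$ becomes an inequality of quadratic forms on the
  span of \<open>D\<close>, by taking the coefficients of \<open>v\<close> as the test vector.
\<close>

lemma congr_loewner_curvature:
  assumes D: "distinct D" and le: "smult_mat \<eta> (congr D id_matrix) \<preceq>\<^sub>M congr D A"
    and v: "v \<in> span (set D)"
  shows "\<eta> * (norm v)\<^sup>2 \<le> inner v (A *v v)"
proof -
  have eq: "congr D A - smult_mat \<eta> (congr D id_matrix) = congr D (A - \<eta> *\<^sub>R id_matrix)"
    by (rule eq_matI) (auto simp: congr_def matrix_vector_mult_diff_rdistrib inner_diff_right
        id_matrix_mult_vec simp flip: scaleR_matrix_vector_assoc)
  obtain c where c: "v = (\<Sum>i<length D. c i *\<^sub>R D ! i)"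
    using span_set_coefficients[OF D v] by blast
  have "Matrix.vec (length D) c \<in> carrier_vec (dim_row (congr D (A - \<eta> *\<^sub>R id_matrix)))"
    by (simp add: congr_def)
  then have "0 \<le> inner v ((A - \<eta> *\<^sub>R id_matrix) *v v)"
    using le unfolding loewner_le_mat_def psd_mat_def eq c congr_quadratic[symmetric] by blast
  then show ?thesis
    by (simp add: matrix_vector_mult_diff_rdistrib inner_diff_right id_matrix_mult_vec
        power2_norm_eq_inner flip: scaleR_matrix_vector_assoc)
qed

section \<open>Line search\<close>

lemma derivative_along_line:
  assumes "\<And>y. GDERIV f y :> g y"
  shows "((\<lambda>t. f (x + t *\<^sub>R d)) has_real_derivative inner (g (x + t *\<^sub>R d)) d) (at t)"
proof -
  have "((\<lambda>t. x + t *\<^sub>R d) has_derivative (\<lambda>h. h *\<^sub>R d)) (at t)"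
    by (auto intro!: derivative_eq_intros)
  then have "((\<lambda>t. f (x + t *\<^sub>R d)) has_derivative (\<lambda>h. inner (h *\<^sub>R d) (g (x + t *\<^sub>R d)))) (at t)"
    by (rule has_derivative_compose) (use assms in \<open>simp add: gderiv_def\<close>)
  moreover have "(\<lambda>h. inner (h *\<^sub>R d) (g (x + t *\<^sub>R d))) = (*) (inner (g (x + t *\<^sub>R d)) d)"
    by (auto simp: inner_commute)
  ultimately show ?thesis by (simp add: has_field_derivative_def)
qed

text \<open>
  Subtract the linear part of the Armijo bound from \<open>f\<close> along the ray. The difference starts with
  negative slope and eventually exceeds its initial value because \<open>f\<close> is bounded below, so on a
  long enough interval it has an interior minimum. There its value is at most the initial one, which is the Armijo condition, and its
  derivative vanishes, so that the slope of \<open>f\<close> is \<open>\<alpha>\<close> times the initial slope, which is more than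
  the Wolfe condition asks for.
\<close>

lemma armijo_wolfe_step_exists:
  fixes f :: "real ^ 'n \<Rightarrow> real"
  assumes gradient: "\<And>y. GDERIV f y :> g y" and bounded: "bdd_below (range f)"
    and descent: "inner (g x) d < 0" and params: "0 < \<alpha>" "\<alpha> < \<beta>" "\<beta> < 1"
  obtains t where "armijo_wolfe f g \<alpha> \<beta> x d t"
proof -
  define m where "m = inner (g x) d"
  define h where "h t = f (x + t *\<^sub>R d) - \<alpha> * t * m" for t
  have deriv: "(h has_real_derivative inner (g (x + t *\<^sub>R d)) d - \<alpha> * m) (at t)" for t
    unfolding h_def by (auto intro!: derivative_eq_intros derivative_along_line[OF gradient])
  obtain L where L: "L \<le> f y" for y
    using bounded by (auto simp: bdd_below_def)
  \<comment> \<open>At this length the Armijo line lies below every value of \<open>f\<close>.\<close>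
  define T where "T = (f x - L + 1) / (- (\<alpha> * m))"
  have "\<alpha> * m < 0" using descent params by (simp add: m_def mult_pos_neg)
  then have T: "T > 0" "h T > h 0"
  proof -
    have "- (\<alpha> * m) > 0" using \<open>\<alpha> * m < 0\<close> by simp
    then show "T > 0" unfolding T_def using L[of x] by (intro divide_pos_pos) auto
    have "T * (- (\<alpha> * m)) = f x - L + 1" using \<open>- (\<alpha> * m) > 0\<close> unfolding T_def
      by (intro nonzero_eq_divide_eq[THEN iffD1]) auto
    then show "h T > h 0" using L[of "x + T *\<^sub>R d"] by (simp add: h_def algebra_simps)
  qed
  have "continuous_on {0..T} h"
    using deriv by (meson DERIV_isCont continuous_at_imp_continuous_on)
  then obtain t where t: "t \<in> {0..T}" "\<And>u. u \<in> {0..T} \<Longrightarrow> h t \<le> h u"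
    using continuous_attains_inf[of "{0..T}" h] T(1) by auto
  have "t \<noteq> T" using t(2)[of 0] T by auto
  moreover have "t \<noteq> 0"
  proof
    assume "t = 0"
    have "inner (g (x + 0 *\<^sub>R d)) d - \<alpha> * m < 0"
      using descent params mult_strict_right_mono_neg[of \<alpha> 1 m] by (simp add: m_def)
    then obtain e where e: "e > 0" "\<And>u. 0 < u \<Longrightarrow> u < e \<Longrightarrow> h (0 + u) < h 0"
      using DERIV_neg_dec_right[OF deriv[of 0]] by blast
    define u where "u = min (e / 2) T"
    have "0 < u" "u < e" "u \<le> T" using e(1) T(1) by (auto simp: u_def)
    then show False using e(2)[of u] t(2)[of u] \<open>t = 0\<close> by auto
  qed
  ultimately have t_in: "0 < t" "t < T" using t(1) by auto
  have "inner (g (x + t *\<^sub>R d)) d - \<alpha> * m = 0"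
  proof (rule DERIV_local_min[OF deriv])
    show "0 < min t (T - t)" using t_in by simp
    show "\<forall>u. \<bar>t - u\<bar> < min t (T - t) \<longrightarrow> h t \<le> h u" by (auto intro!: t(2))
  qed
  moreover have "\<beta> * m \<le> \<alpha> * m"
    using descent params by (simp add: m_def mult_right_mono_neg)
  moreover have "h t \<le> h 0" using t(2)[of 0] T(1) by simp
  ultimately have "armijo_wolfe f g \<alpha> \<beta> x d t"
    using t_in by (simp add: armijo_wolfe_def m_def h_def algebra_simps)
  then show ?thesis using that by blast
qed

lemma selectable_exists:
  fixes f :: "real ^ 'n \<Rightarrow> real"
  assumes "\<And>y. GDERIV f y :> g y" "bdd_below (range f)" "inner (g x) d < 0"
    "0 < \<alpha>" "\<alpha> < \<beta>" "\<beta> < 1"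
  shows "\<exists>t. selectable f g \<alpha> \<beta> x d t"
  using armijo_wolfe_step_exists[of f g x d \<alpha> \<beta>] assms unfolding selectable_def by metis

lemma gradient_increment_bound:
  fixes g :: "real ^ 'n \<Rightarrow> real ^ 'n"
  assumes hessian: "\<And>y. (g has_derivative (\<lambda>h. G y *v h)) (at y)"
    and "convex S" "x \<in> S" "x + s \<in> S"
    and quad: "\<And>y. y \<in> S \<Longrightarrow> inner s (G y *v s) \<le> M * (norm s)\<^sup>2"
  shows "inner (g (x + s)) s - inner (g x) s \<le> M * (norm s)\<^sup>2"
proof -
  have deriv: "((\<lambda>t. inner (g (x + t *\<^sub>R s)) s) has_real_derivative inner s (G (x + t *\<^sub>R s) *v s)) (at t)" for t
  proof -
    have "((\<lambda>t. x + t *\<^sub>R s) has_derivative (\<lambda>h. h *\<^sub>R s)) (at t)"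
      by (auto intro!: derivative_eq_intros)
    then have "((\<lambda>t. g (x + t *\<^sub>R s)) has_derivative (\<lambda>h. G (x + t *\<^sub>R s) *v (h *\<^sub>R s))) (at t)"
      by (rule has_derivative_compose) (rule hessian)
    then have "((\<lambda>t. inner (g (x + t *\<^sub>R s)) s) has_derivative
        (\<lambda>h. inner (G (x + t *\<^sub>R s) *v (h *\<^sub>R s)) s)) (at t)"
      by (rule has_derivative_inner_left)
    moreover have "(\<lambda>h. inner (G (x + t *\<^sub>R s) *v (h *\<^sub>R s)) s) = (*) (inner s (G (x + t *\<^sub>R s) *v s))"
      by (auto simp: matrix_vector_mult_scaleR inner_commute)
    ultimately show ?thesis by (simp add: has_field_derivative_def)
  qed
  obtain t where t: "0 < t" "t < 1"
    "inner (g (x + 1 *\<^sub>R s)) s - inner (g (x + 0 *\<^sub>R s)) s = (1 - 0) * inner s (G (x + t *\<^sub>R s) *v s)"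
    using MVT2[of 0 1 "\<lambda>t. inner (g (x + t *\<^sub>R s)) s"] deriv by force
  have "(1 - t) *\<^sub>R x + t *\<^sub>R (x + s) \<in> S"
    using assms t by (intro convexD) auto
  moreover have "(1 - t) *\<^sub>R x + t *\<^sub>R (x + s) = x + t *\<^sub>R s" by (simp add: algebra_simps)
  ultimately show ?thesis using quad[of "x + t *\<^sub>R s"] t(3) by simp
qed

text \<open>
  The Wolfe condition and the Hessian bound give
  $(1 - \beta) (- \langle g, s \rangle) \le M \|s\|^2$, hence
  $\langle g, s \rangle^2 / \|s\|^2$ is at most a constant times $- \langle g, s \rangle$. The latter
  tends to zero, since by the Armijo condition it is at most a constant times the decrease of \<open>f\<close>.
\<close>

lemma zoutendijk:
  fixes f :: "real ^ 'n \<Rightarrow> real" and X s :: "nat \<Rightarrow> real ^ 'n"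
  assumes hessian: "\<And>y. (g has_derivative (\<lambda>h. G y *v h)) (at y)"
    and quad: "\<And>y h. y \<in> convex hull {z. f z \<le> f (X 0)} \<Longrightarrow> inner h (G y *v h) \<le> M * (norm h)\<^sup>2"
    and bounded: "bdd_below (range f)"
    and step: "\<And>N. X (Suc N) = X N + s N"
    and descent: "\<And>N. inner (g (X N)) (s N) < 0"
    and armijo: "\<And>N. f (X (Suc N)) \<le> f (X N) + \<alpha> * inner (g (X N)) (s N)"
    and wolfe: "\<And>N. \<beta> * inner (g (X N)) (s N) \<le> inner (g (X (Suc N))) (s N)"
    and params: "0 < \<alpha>" "\<beta> < 1"
  shows "(\<lambda>N. (inner (g (X N)) (s N))\<^sup>2 / (norm (s N))\<^sup>2) \<longlonglongrightarrow> 0"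
proof -
  define e where "e N = - inner (g (X N)) (s N)" for N
  have e_pos: "e N > 0" for N using descent by (simp add: e_def)
  have armijo': "\<alpha> * e N \<le> f (X N) - f (X (Suc N))" for N
    using armijo[of N] by (simp add: e_def)
  have mono: "f (X (Suc N)) \<le> f (X N)" for N
    using armijo'[of N] mult_pos_pos[OF params(1) e_pos[of N]] by linarith
  then have dec: "decseq (\<lambda>N. f (X N))" by (simp add: decseq_Suc_iff)
  obtain L where "L \<le> f y" for y
    using bounded by (auto simp: bdd_below_def)
  then obtain l where l: "(\<lambda>N. f (X N)) \<longlonglongrightarrow> l"
    using decseq_convergent[OF dec, of L] by blast
  have "(\<lambda>N. (f (X N) - f (X (Suc N))) / \<alpha>) \<longlonglongrightarrow> (l - l) / \<alpha>"
    using l LIMSEQ_Suc[OF l] params by (intro tendsto_intros) auto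
  then have diff: "(\<lambda>N. (f (X N) - f (X (Suc N))) / \<alpha>) \<longlonglongrightarrow> 0" by simp
  have e_lim: "e \<longlonglongrightarrow> 0"
  proof (rule tendsto_sandwich[OF _ _ tendsto_const diff])
    show "\<forall>\<^sub>F N in sequentially. 0 \<le> e N" using less_imp_le[OF e_pos] by simp
    show "\<forall>\<^sub>F N in sequentially. e N \<le> (f (X N) - f (X (Suc N))) / \<alpha>"
      using armijo' params by (simp add: pos_le_divide_eq mult.commute)
  qed
  let ?S = "convex hull {z. f z \<le> f (X 0)}"
  have in_S: "X N \<in> ?S" for N
    using decseqD[OF dec, of 0 N] by (simp add: hull_inc)
  have bound: "(1 - \<beta>) * e N \<le> M * (norm (s N))\<^sup>2" for N
  proof -
    have "inner (g (X N + s N)) (s N) - inner (g (X N)) (s N) \<le> M * (norm (s N))\<^sup>2"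
      using in_S[of N] in_S[of "Suc N"] quad
      by (intro gradient_increment_bound[OF hessian, of ?S]) (auto simp: step)
    then show ?thesis using wolfe[of N] by (simp add: step e_def algebra_simps)
  qed
  have upper: "(inner (g (X N)) (s N))\<^sup>2 / (norm (s N))\<^sup>2 \<le> M / (1 - \<beta>) * e N" for N
  proof -
    have "s N \<noteq> 0" using descent[of N] by auto
    then have pos: "(norm (s N))\<^sup>2 > 0" by simp
    have "e N \<le> M / (1 - \<beta>) * (norm (s N))\<^sup>2"
      using bound[of N] params by (simp add: field_simps)
    then have "e N * e N \<le> e N * (M / (1 - \<beta>) * (norm (s N))\<^sup>2)"
      using e_pos[of N] by (intro mult_left_mono) auto
    then have "(e N)\<^sup>2 \<le> M / (1 - \<beta>) * e N * (norm (s N))\<^sup>2"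
      by (simp only: power2_eq_square mult_ac)
    then have "(e N)\<^sup>2 / (norm (s N))\<^sup>2 \<le> M / (1 - \<beta>) * e N"
      using pos by (simp only: pos_divide_le_eq)
    then show ?thesis by (simp add: e_def)
  qed
  have lim: "(\<lambda>N. M / (1 - \<beta>) * e N) \<longlonglongrightarrow> 0"
    using tendsto_mult_left[OF e_lim, of "M / (1 - \<beta>)"] by simp
  show ?thesis
    by (rule tendsto_sandwich[OF always_eventually[OF allI] always_eventually[OF allI[OF upper]]
          tendsto_const lim]) simp
qed

section \<open>Runs of the algorithm\<close>

lemma pos_def_matrix_inv:
  assumes "pos_def B"
  shows "B *v (matrix_inv B *v v) = v"
proof -
  have "invertible B" using pos_def_det_nonzero[OF assms] by (simp add: invertible_det_nz)
  then have "B ** matrix_inv B = Finite_Cartesian_Product.mat 1"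
    unfolding invertible_def matrix_inv_def by (rule someI2_ex) auto
  then show ?thesis by (simp add: matrix_vector_mul_assoc)
qed

lemma mult_direction: "pos_def (B k) \<Longrightarrow> B k *v direction g B x k i = - g (x k i)"
  using pos_def_matrix_inv[of "B k" "g (x k i)"]
  by (simp add: direction_def linear_neg[OF matrix_vector_mul_linear])

lemma direction_nonzero: "pos_def (B k) \<Longrightarrow> g (x k i) \<noteq> 0 \<Longrightarrow> direction g B x k i \<noteq> 0"
  using mult_direction[of B k g x i] by auto

lemma direction_descent:
  assumes "pos_def (B k)" "g (x k i) \<noteq> 0"
  shows "inner (g (x k i)) (direction g B x k i) < 0"
  using pos_def_pos[OF assms(1) direction_nonzero[of B k g x i, OF assms]]
    mult_direction[of B k g x i, OF assms(1)] by (simp add: inner_commute)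

text \<open>
  The filter test is strict because no step is zero: $B_k$ is positive definite and the gradient
  does not vanish.
\<close>

lemma definite_on_retained:
  assumes sym: "Finite_Cartesian_Product.transpose (Gt k) = Gt k" and "\<tau> > 0" and B: "pos_def (B k)"
    and steps: "\<And>i. i \<in> {1..q} \<Longrightarrow> inner_step f g \<alpha> \<beta> B x lam k i"
  shows "definite_on (Gt k) (retained g q \<tau> Gt B x lam k)"
proof -
  have "lam k i *\<^sub>R direction g B x k i \<noteq> 0" if "i \<in> {1..q}" for i
    using steps[OF that] direction_nonzero[of B k g x i, OF B]
    by (auto simp: inner_step_def selectable_def armijo_wolfe_def)
  then have "0 \<notin> set (step_matrix g q B x lam k)"
    by (force simp: step_matrix_def simp del: upt_Suc)
  then show ?thesis
    unfolding retained_def by (rule definite_on_filter_steps[OF sym \<open>\<tau> > 0\<close>])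
qed

lemma bfgs_until_pos_def:
  assumes run: "bfgs_until f g q \<tau> \<alpha> \<beta> x1 B1 Gt B x lam K I" and "\<tau> > 0" "pos_def B1"
    and adm: "\<And>k. k \<in> {1..<K} \<Longrightarrow> admissible M \<eta> (retained g q \<tau> Gt B x lam k) (Gt k)"
    and k: "1 \<le> k" "k \<le> K"
  shows "pos_def (B k)"
  using k
proof (induction k rule: dec_induct)
  case base
  then show ?case using run \<open>pos_def B1\<close> by (simp add: bfgs_until_def)
next
  case (step k)
  then have k: "k \<in> {1..<K}" and B: "pos_def (B k)" by auto
  have sym: "Finite_Cartesian_Product.transpose (Gt k) = Gt k"
    using adm[OF k] by (simp add: admissible_def)
  have "inner_step f g \<alpha> \<beta> B x lam k i" if "i \<in> {1..q}" for i
    using run k that by (auto simp: bfgs_until_def)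
  then have "definite_on (Gt k) (retained g q \<tau> Gt B x lam k)"
    by (intro definite_on_retained[of Gt k \<tau> B, OF sym \<open>\<tau> > 0\<close> B])
  moreover have "B (Suc k) = block_update (B k) (Gt k) (retained g q \<tau> Gt B x lam k)"
    using run k by (auto simp: bfgs_until_def outer_step_def)
  ultimately show ?case using pos_def_block_update[OF B sym] by simp
qed

lemma retained_subset: "set (retained g q \<tau> Gt B x lam k)
    \<subseteq> (\<lambda>i. lam k i *\<^sub>R direction g B x k i) ` {1..q}"
  using set_filter_from[of \<tau> "Gt k" "[]" "step_matrix g q B x lam k"]
  by (auto simp: retained_def filter_steps_def step_matrix_def simp del: upt_Suc)

lemma length_retained: "length (retained g q \<tau> Gt B x lam k) \<le> q"
  using length_filter_from[of \<tau> "Gt k" "[]" "step_matrix g q B x lam k"]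
  by (simp add: retained_def filter_steps_def step_matrix_def del: upt_Suc)

text \<open>
  At most \<open>q\<close> columns are retained, so \<open>q * growth M \<eta>\<close> bounds the growth of the merit function,
  and the cosine term of the first retained step outweighs it. Which step that is depends on the
  filter, so all steps of the block are assumed to have small cosines. If none is retained, the
  matrix does not change.
\<close>

lemma merit_block_step:
  assumes adm: "admissible M \<eta> (retained g q \<tau> Gt B x lam k) (Gt k)" and "\<tau> > 0" "\<eta> > 0"
    and B: "pos_def (B k)"
    and steps: "\<And>i. i \<in> {1..q} \<Longrightarrow> inner_step f g \<alpha> \<beta> B x lam k i"
    and outer: "outer_step g q \<tau> Gt B x lam k"
    and small: "\<And>i. i \<in> {1..q} \<Longrightarrow>
        ln (cos2 (B k) (lam k i *\<^sub>R direction g B x k i)) \<le> - (q * growth M \<eta>)"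
  shows "merit (B (Suc k)) \<le> merit (B k)"
proof -
  let ?D = "retained g q \<tau> Gt B x lam k"
  have B': "B (Suc k) = block_update (B k) (Gt k) ?D"
    using outer by (simp add: outer_step_def)
  show ?thesis
  proof (cases "?D = []")
    case True
    then show ?thesis using B' by (simp add: block_update_def)
  next
    case False
    have sym: "Finite_Cartesian_Product.transpose (Gt k) = Gt k"
      using adm by (simp add: admissible_def)
    have D: "definite_on (Gt k) ?D"
      by (rule definite_on_retained[of Gt k \<tau> B, OF sym \<open>\<tau> > 0\<close> B steps])
    have curv: "\<eta> * (norm v)\<^sup>2 \<le> inner v (Gt k *v v)" if "v \<in> span (set ?D)" for v
      using adm False D that by (intro congr_loewner_curvature) (auto simp: admissible_def definite_on_def)
    have norm: "norm (Gt k *v v) \<le> M * norm v" for v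
      using adm by (intro symmetric_norm_bound[OF sym] loewner_bounds_quadratic) (auto simp: admissible_def)
    have "hd ?D \<in> set ?D" using False by simp
    then obtain i where "i \<in> {1..q}" "hd ?D = lam k i *\<^sub>R direction g B x k i"
      using retained_subset[of g q \<tau> Gt B x lam k] by blast
    then have "ln (cos2 (B k) (hd ?D)) \<le> - (q * growth M \<eta>)" using small by simp
    moreover have "real (length ?D) * growth M \<eta> \<le> q * growth M \<eta>"
      using length_retained[of g q \<tau> Gt B x lam k]
      by (intro mult_right_mono) (auto simp: growth_def)
    ultimately show ?thesis
      using merit_block_update[OF B sym D \<open>\<eta> > 0\<close> curv norm] False B' by simp
  qed
qed

theorem theorem6p1:
  fixes f :: "real ^ 'n \<Rightarrow> real"
    and g :: "real ^ 'n \<Rightarrow> real ^ 'n"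
    and G :: "real ^ 'n \<Rightarrow> real ^ 'n ^ 'n"
    and x1 :: "real ^ 'n" and B1 :: "real ^ 'n ^ 'n"
    and q :: nat and \<tau> \<alpha> \<beta> M \<eta> :: real
    and Gt B :: "nat \<Rightarrow> real ^ 'n ^ 'n"
    and x :: "nat \<Rightarrow> nat \<Rightarrow> real ^ 'n"
    and lam :: "nat \<Rightarrow> nat \<Rightarrow> real"
  assumes gradient: "\<And>y. GDERIV f y :> g y"
    and hessian: "\<And>y. (g has_derivative (\<lambda>h. G y *v h)) (at y)"
    and M: "M > 0"
    and hessian_bounds: "\<And>y. y \<in> convex hull {z. f z \<le> f x1} \<Longrightarrow>
          - (M *\<^sub>R id_matrix) \<preceq>\<^sub>L G y \<and> G y \<preceq>\<^sub>L M *\<^sub>R id_matrix"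
    and bounded_below: "bdd_below (range f)"
    and B1: "pos_def B1"
    and params: "q \<ge> 1" "\<tau> > 0" "0 < \<alpha>" "\<alpha> < 1/2" "\<alpha> < \<beta>" "\<beta> < 1"
    and \<eta>: "\<eta> > 0"
  shows "(\<forall>K I. 1 \<le> K \<and> 1 \<le> I \<and> I \<le> Suc q \<and>
            bfgs_until f g q \<tau> \<alpha> \<beta> x1 B1 Gt B x lam K I \<and>
            (\<forall>k \<in> {1..<K}. admissible M \<eta> (retained g q \<tau> Gt B x lam k) (Gt k)) \<longrightarrow>
            (\<forall>k \<in> {1..K}. pos_def (B k)) \<and>
            (\<forall>k \<in> {1..<K}. retained g q \<tau> Gt B x lam k \<noteq> [] \<longrightarrow>
               invertible_mat (congr (retained g q \<tau> Gt B x lam k) (B k)) \<and>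
               invertible_mat (congr (retained g q \<tau> Gt B x lam k) (Gt k))) \<and>
            (I \<le> q \<and> g (x K I) \<noteq> 0 \<longrightarrow>
               (\<exists>t. selectable f g \<alpha> \<beta> (x K I) (direction g B x K I) t)))
       \<and> (bfgs_run f g q \<tau> \<alpha> \<beta> x1 B1 Gt B x lam \<and>
            (\<forall>k \<ge> 1. admissible M \<eta> (retained g q \<tau> Gt B x lam k) (Gt k)) \<longrightarrow>
            liminf (\<lambda>N. ereal (norm (g (iterate q x N)))) = 0)"
proof (intro conjI allI impI; (elim conjE)?)
  fix K I
  assume run: "bfgs_until f g q \<tau> \<alpha> \<beta> x1 B1 Gt B x lam K I" and "1 \<le> K"
    and adm: "\<forall>k \<in> {1..<K}. admissible M \<eta> (retained g q \<tau> Gt B x lam k) (Gt k)"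
  have pd: "pos_def (B k)" if "k \<in> {1..K}" for k
    using that adm by (intro bfgs_until_pos_def[OF run params(2) B1]) auto
  then show "\<forall>k \<in> {1..K}. pos_def (B k)" by blast
  show "\<forall>k \<in> {1..<K}. retained g q \<tau> Gt B x lam k \<noteq> [] \<longrightarrow>
       invertible_mat (congr (retained g q \<tau> Gt B x lam k) (B k)) \<and>
       invertible_mat (congr (retained g q \<tau> Gt B x lam k) (Gt k))"
  proof (intro ballI impI)
    fix k assume k: "k \<in> {1..<K}"
    have "definite_on (Gt k) (retained g q \<tau> Gt B x lam k)"
      using run k adm pd[of k]
      by (intro definite_on_retained[where f = f and \<alpha> = \<alpha> and \<beta> = \<beta>, OF _ params(2)]) (auto simp: bfgs_until_def admissible_def)
    then show "invertible_mat (congr (retained g q \<tau> Gt B x lam k) (B k)) \<and>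
       invertible_mat (congr (retained g q \<tau> Gt B x lam k) (Gt k))"
      using definite_on_pos_def pd[of k] k by (auto intro!: invertible_congr)
  qed
  show "\<exists>t. selectable f g \<alpha> \<beta> (x K I) (direction g B x K I) t" if "g (x K I) \<noteq> 0"
    using direction_descent[of B K g x I] pd[of K] that \<open>1 \<le> K\<close> params
    by (intro selectable_exists[OF gradient bounded_below]) auto
next
  assume run: "bfgs_run f g q \<tau> \<alpha> \<beta> x1 B1 Gt B x lam"
    and adm: "\<forall>k \<ge> 1. admissible M \<eta> (retained g q \<tau> Gt B x lam k) (Gt k)"
  have pd: "pos_def (B k)" if "k \<ge> 1" for k
  proof (rule bfgs_until_pos_def[where K = k and I = 1])
    show "bfgs_until f g q \<tau> \<alpha> \<beta> x1 B1 Gt B x lam k 1"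
      using run by (auto simp: bfgs_run_def bfgs_until_def)
  qed (use adm params B1 that in auto)
  have steps: "inner_step f g \<alpha> \<beta> B x lam k i" if "k \<ge> 1" "i \<in> {1..q}" for k i
    using run that by (auto simp: bfgs_run_def)
  have outer: "outer_step g q \<tau> Gt B x lam k" if "k \<ge> 1" for k
    using run that by (auto simp: bfgs_run_def)
  define X where "X = iterate q x"
  define blk where "blk N = Suc (N div q)" for N
  define idx where "idx N = Suc (N mod q)" for N
  define s where "s N = lam (blk N) (idx N) *\<^sub>R direction g B x (blk N) (idx N)" for N
  have X: "X N = x (blk N) (idx N)" for N by (simp add: X_def iterate_def blk_def idx_def)
  have blk: "blk N \<ge> 1" and idx: "idx N \<in> {1..q}" for N
    using params(1) by (auto simp: blk_def idx_def Suc_le_eq)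
  have stepN: "inner_step f g \<alpha> \<beta> B x lam (blk N) (idx N)" for N
    using steps[OF blk idx] .
  have pdN: "pos_def (B (blk N))" for N using pd[OF blk] .
  have gN: "g (X N) \<noteq> 0" for N using stepN by (simp add: inner_step_def X)
  have lamN: "lam (blk N) (idx N) > 0" for N
    using stepN by (simp add: inner_step_def selectable_def armijo_wolfe_def)
  have X_Suc: "X (Suc N) = X N + s N" for N
  proof -
    have "x (blk N) (Suc (idx N)) = X N + s N"
      using stepN[of N] by (simp add: inner_step_def X s_def)
    moreover have "X (Suc N) = x (blk N) (Suc (idx N))"
    proof (cases "Suc (N mod q) = q")
      case True
      then show ?thesis
        using outer[OF blk[of N]] by (simp add: X outer_step_def blk_def idx_def div_Suc mod_Suc)
    next
      case False
      then show ?thesis by (simp add: X blk_def idx_def div_Suc mod_Suc)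
    qed
    ultimately show ?thesis by simp
  qed
  have descent: "inner (g (X N)) (s N) < 0" for N
    using direction_descent[of B "blk N" g x "idx N"] pdN gN lamN[of N]
    by (simp add: X s_def mult_pos_neg)
  have Bs: "B (blk N) *v s N = - (lam (blk N) (idx N) *\<^sub>R g (X N))" for N
    using mult_direction[of B "blk N" g x "idx N"] pdN
    by (simp add: s_def matrix_vector_mult_scaleR X)
  have s0: "s N \<noteq> 0" for N using descent[of N] by auto
  have zout: "(\<lambda>N. (inner (g (X N)) (s N))\<^sup>2 / (norm (s N))\<^sup>2) \<longlonglongrightarrow> 0"
  proof (rule zoutendijk[where f = f and g = g and X = X and s = s and G = G and M = M and \<alpha> = \<alpha> and \<beta> = \<beta>])
    have "X 0 = x1" using run by (simp add: X blk_def idx_def bfgs_run_def)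
    then show "inner h (G y *v h) \<le> M * (norm h)\<^sup>2" if "y \<in> convex hull {z. f z \<le> f (X 0)}" for y h
      using loewner_bounds_quadratic[of M "G y" h] hessian_bounds[of y] that by auto
    show "f (X (Suc N)) \<le> f (X N) + \<alpha> * inner (g (X N)) (s N)" for N
      using stepN[of N] unfolding X_Suc
      by (simp add: inner_step_def selectable_def armijo_wolfe_def X s_def mult.assoc)
    show "\<beta> * inner (g (X N)) (s N) \<le> inner (g (X (Suc N))) (s N)" for N
    proof -
      have "\<beta> * inner (g (X N)) (direction g B x (blk N) (idx N))
          \<le> inner (g (X (Suc N))) (direction g B x (blk N) (idx N))"
        using stepN[of N] unfolding X_Suc
        by (simp add: inner_step_def selectable_def armijo_wolfe_def X s_def)
      from mult_left_mono[OF this less_imp_le[OF lamN[of N]]] show ?thesis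
        by (simp add: s_def mult.left_commute)
    qed
  qed (use hessian bounded_below X_Suc descent params in auto)
  define cosN where "cosN N = cos2 (B (blk N)) (s N)" for N
  \<comment> \<open>Since \<open>B s = - \<lambda> g\<close>, the factor \<open>\<lambda>\<close> cancels in the cosine.\<close>
  have cos_eq: "cosN N = (inner (g (X N)) (s N))\<^sup>2 / (norm (s N))\<^sup>2 / (norm (g (X N)))\<^sup>2" for N
    using lamN[of N] by (simp add: cosN_def cos2_def Bs power_mult_distrib inner_commute)
  show "liminf (\<lambda>N. ereal (norm (g (iterate q x N)))) = 0"
  proof (rule ccontr)
    assume "liminf (\<lambda>N. ereal (norm (g (iterate q x N)))) \<noteq> 0"
    moreover have "0 \<le> liminf (\<lambda>N. ereal (norm (g (iterate q x N))))"
      by (rule Liminf_bounded) auto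
    ultimately have "0 < liminf (\<lambda>N. ereal (norm (g (X N))))"
      by (simp add: X_def)
    then obtain \<delta> where "0 < ereal \<delta>" "ereal \<delta> < liminf (\<lambda>N. ereal (norm (g (X N))))"
      using ereal_dense2 by blast
    then have \<delta>: "\<delta> > 0" "\<forall>\<^sub>F N in sequentially. \<delta> < norm (g (X N))"
      using less_LiminfD[of "ereal \<delta>" sequentially "\<lambda>N. ereal (norm (g (X N)))"] by auto
    have cos_lim: "cosN \<longlonglongrightarrow> 0"
    proof (rule tendsto_sandwich[OF _ _ tendsto_const])
      show "\<forall>\<^sub>F N in sequentially. 0 \<le> cosN N" by (simp add: cosN_def cos2_def)
      show "\<forall>\<^sub>F N in sequentially.
          cosN N \<le> (inner (g (X N)) (s N))\<^sup>2 / (norm (s N))\<^sup>2 / \<delta>\<^sup>2"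
        using \<delta>(2)
      proof eventually_elim
        case (elim N)
        then have "\<delta>\<^sup>2 \<le> (norm (g (X N)))\<^sup>2" using \<delta>(1) by (intro power_mono) auto
        then show ?case unfolding cos_eq using \<delta>(1) gN[of N] by (intro divide_left_mono) auto
      qed
      show "(\<lambda>N. (inner (g (X N)) (s N))\<^sup>2 / (norm (s N))\<^sup>2 / \<delta>\<^sup>2) \<longlonglongrightarrow> 0"
        using tendsto_divide[OF zout tendsto_const[of "\<delta>\<^sup>2"]] \<delta>(1) by simp
    qed
    have small: "\<forall>\<^sub>F N in sequentially. ln (cosN N) < b" for b
    proof -
      have "\<forall>\<^sub>F N in sequentially. cosN N < exp b"
        using cos_lim by (rule order_tendstoD) simp
      then show ?thesis
      proof eventually_elim
        case (elim N)
        then show ?case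
          using cos2_pos[OF pdN[of N] s0[of N]]
          by (metis cosN_def exp_less_cancel_iff exp_ln)
      qed
    qed
    obtain N0 where N0: "\<And>N. N \<ge> N0 \<Longrightarrow> ln (cosN N) < - (q * growth M \<eta>)"
      using small unfolding eventually_sequentially by blast
    have decrease: "merit (B (Suc k)) \<le> merit (B k)" if k: "k \<ge> Suc N0" for k
    proof (rule merit_block_step[where f = f and g = g and M = M and \<eta> = \<eta>
          and \<alpha> = \<alpha> and \<beta> = \<beta>])
      show "admissible M \<eta> (retained g q \<tau> Gt B x lam k) (Gt k)" using adm k by simp
      show "ln (cos2 (B k) (lam k i *\<^sub>R direction g B x k i)) \<le> - (q * growth M \<eta>)"
        if i: "i \<in> {1..q}" for i
      proof -
        obtain m j where m: "k = Suc m" "N0 \<le> m" and j: "i = Suc j" "j < q"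
          using k i by (cases k; cases i) auto
        \<comment> \<open>The position of step \<open>i\<close> of block \<open>k\<close> in the sequence of all iterates.\<close>
        define N where "N = m * q + j"
        have "blk N = k" "idx N = i" using m j by (auto simp: blk_def idx_def N_def)
        moreover have "N \<ge> N0"
        proof -
          have "N0 * 1 \<le> m * q" using m(2) params(1) by (rule mult_le_mono)
          then show ?thesis by (simp add: N_def)
        qed
        ultimately show ?thesis using N0[of N] by (simp add: cosN_def s_def)
      qed
    qed (use params \<eta> pd steps outer k in auto)
    have merit_le: "merit (B k) \<le> merit (B (Suc N0))" if "k \<ge> Suc N0" for k
      using that by (induction k rule: dec_induct) (auto intro: order_trans[OF decrease])
    \<comment> \<open>An upper bound on the merit function along the run bounds the cosines away from zero.\<close>
    obtain c where c: "\<And>(B :: real ^ 'n ^ 'n) s. pos_def B \<Longrightarrow> s \<noteq> 0 \<Longrightarrow> c - merit B \<le> ln (cos2 B s)"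
      using ln_cos2_lower_bound by blast
    obtain N1 where N1: "\<And>N. N \<ge> N1 \<Longrightarrow> ln (cosN N) < c - merit (B (Suc N0))"
      using small unfolding eventually_sequentially by blast
    \<comment> \<open>An index that is late enough and lies in a block to which \<open>merit_le\<close> applies.\<close>
    define N where "N = max N1 (N0 * q)"
    have "N0 \<le> N div q" using params(1) by (simp add: N_def less_eq_div_iff_mult_less_eq)
    then have "c - merit (B (Suc N0)) \<le> ln (cosN N)"
      using c[OF pdN s0, of N N] merit_le[of "blk N"] by (simp add: cosN_def blk_def)
    then show False using N1[of N] by (simp add: N_def)
  qed
qed

end
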